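(* Let $\hat a,\underline a,\hat b,\underline b:\mathcal Z\to\mathbb R$ be fixed bounded measurable functions, with $\underline a,\underline b$ (positive and) bounded away from zero and infinity, and let $L$ be a finite-dimensional subspace of $L_2(\nu)$. Let $\tilde\chi$ be the approximate functional defined in the context. For $m\ge2$, an $m$th order influence function $\tilde\chi^{(m)}_p$ of $\tilde\chi$, evaluated at $(X_1,\dots,X_m)$, is the degenerate (in $L_2(p)$) part of the variable $$(-1)^{m-1}m!\,\tilde A_1\,\Pi_{1,2}\,\underline A_2\,\Pi_{2,3}\,\underline A_3\,\Pi_{3,4}\,\underline A_4\times\cdots\times\underline A_{m-1}\,\Pi_{m-1,m}\,\tilde Y_m .$$ Here $\Pi_{i,j}$ is the kernel of the orthogonal projection in $L_2(\underline a\,\underline b\,g)$ onto $L$, evaluated at $(Z_i,Z_j)$.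
   Context: Model. $X=(YA,A,Z)$, where $Y,A\in\{0,1\}$ are conditionally independent given $Z\in\mathcal Z$. $Z$ has density $f$ with respect to a measure $\nu$ on $\mathcal Z$; $b(z)=\Pr(Y=1\mid Z=z)$; $1/a(z)=\Pr(A=1\mid Z=z)$; $g=f/a$. The law $P$ (density $p$) corresponds one-to-one to $(a,b,f)$, equivalently $(a,b,g)$. Standing assumption: $1/a,b$ are bounded away from $0$ and $1$, and $g$ is bounded away from $0$ and $\infty$. $\chi(p)=\int abg\,d\nu$. Approximate functional. $(\tilde a-\hat a)/\underline a$ and $(\tilde b-\hat b)/\underline b$ are the orthogonal projections of $(a-\hat a)/\underline a$ and $(b-\hat b)/\underline b$ onto $L$ in $L_2(\underline a\,\underline b\,g)$; thus $\tilde a,\tilde b$ depend on $p$. $\tilde\chi(p)=\mathrm E_p\bigl[A\tilde a(Z)(Y-\tilde b(Z))+\tilde b(Z)\bigr]$ (equivalently $\chi(\tilde p)+P\chi^{(1)}_{\tilde p}$ with $\chi(\tilde p)=\int\tilde a\tilde bg\,d\nu$ and $\chi^{(1)}_{\tilde p}=A\tilde a(Z)(Y-\tilde b(Z))+\tilde b(Z)-\chi(\tilde p)$). Variables. $\tilde Y=A(Y-\tilde b(Z))\underline a(Z)$, $\tilde A=(A\tilde a(Z)-1)\underline b(Z)$, $\underline A=A\,\underline a(Z)\underline b(Z)$; an index $i$ means evaluation at the $i$th of i.i.d. copies $X_i=(Y_iA_i,A_i,Z_i)$ of $X$. Kernel. If $e_1,\dots,e_k$ is a basis of $L$ and $C_{ij}=\int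 e_ie_j\,\underline a\,\underline b\,g\,d\nu$, the projection kernel is $\Pi(z_1,z_2)=\sum_{i,j}(C^{-1})_{ij}e_i(z_1)e_j(z_2)$, so that the projection of $h$ is $\int\Pi(\cdot,z_2)h(z_2)(\underline a\,\underline b\,g)(z_2)\,d\nu(z_2)$. Degenerate part. For $h=h(X_1,\dots,X_m)$: $D_Ph=\sum_{B\subset\{1,\dots,m\}}(-1)^{m-|B|}\mathrm E_P\bigl[h(X_1,\dots,X_m)\mid X_i:i\in B\bigr]$. Meaning of the conclusion. Put $\tilde\chi^{(1)}_p(X)=A\tilde a(Z)(Y-\tilde b(Z))+\tilde b(Z)-\chi(\tilde p)$. The functions $\tilde\chi^{(j)}_p$ are called $j$th order influence functions, $j=1,2,\ldots$, if for every $m$, every $1\le j\le m$, and every path $t\mapsto p_t\leftrightarrow(a_t,b_t,f_t)$ with $a_t=a+t\mathfrak a$, $b_t=b+t\mathfrak b$, $f_t=f(1+t\mathfrak f)$, for bounded measurable $\mathfrak a,\mathfrak b,\mathfrak f$ with $\int\mathfrak f f\,d\nu=0$, $$\frac{d^j}{dt^j}\Big|_{t=0}\tilde\chi(p_t)=\frac{d^j}{dt^j}\Big|_{t=0}\Bigl(P_t\tilde\chi^{(1)}_p+\tfrac12P_t^2\tilde\chi^{(2)}_p+\cdots+\tfrac1{m!}P_t^m\tilde\chi^{(m)}_p\Bigr),$$ where $P_t^i h$ is the expectation of $h(X_1,\dots,X_i)$ for $X_1,\dots,X_i$ i.i.d. with density $p_t$. *)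

theory Defs
  imports "HOL-Probability.Probability" "Jordan_Normal_Form.Gauss_Jordan_Elimination"
begin

definition bounded_meas :: "'z measure \<Rightarrow> ('z \<Rightarrow> real) \<Rightarrow> bool" where
  "bounded_meas \<nu> u \<longleftrightarrow> u \<in> borel_measurable \<nu> \<and> (\<exists>M. \<forall>z\<in>space \<nu>. \<bar>u z\<bar> \<le> M)"

definition bounded_away :: "'z measure \<Rightarrow> real set \<Rightarrow> ('z \<Rightarrow> real) \<Rightarrow> bool" where
  \<comment> \<open>\<open>u\<close> takes its values in a compact subinterval of the interval \<open>I\<close>; used with \<open>I = {0<..<1}\<close>
     (away from 0 and 1) and \<open>I = {0<..}\<close> (positive, away from 0 and infinity).\<close>
  "bounded_away \<nu> I u \<longleftrightarrow> (\<exists>l\<in>I. \<exists>r\<in>I. \<forall>z\<in>space \<nu>. l \<le> u z \<and> u z \<le> r)"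

definition model :: "'z measure \<Rightarrow> ('z \<Rightarrow> real) \<Rightarrow> ('z \<Rightarrow> real) \<Rightarrow> ('z \<Rightarrow> real) \<Rightarrow> bool" where
  \<comment> \<open>The bounds make \<open>f\<close> bounded away from 0, so \<open>\<nu>\<close> is automatically a finite measure.\<close>
  "model \<nu> a b f \<longleftrightarrow>
     a \<in> borel_measurable \<nu> \<and> b \<in> borel_measurable \<nu> \<and> f \<in> borel_measurable \<nu> \<and>
     integrable \<nu> f \<and> (\<integral>z. f z \<partial>\<nu>) = 1 \<and>
     bounded_away \<nu> {0<..<1} (\<lambda>z. 1 / a z) \<and>
     bounded_away \<nu> {0<..<1} b \<and>
     bounded_away \<nu> {0<..} (\<lambda>z. f z / a z)"

text \<open>An observation is \<open>(Y A, A, Z)\<close>, with the binary variables encoded as Booleans.\<close>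

type_synonym 'z obs = "bool \<times> bool \<times> 'z"

abbreviation obs_A :: "'z obs \<Rightarrow> real" where
  "obs_A x \<equiv> of_bool (fst (snd x))"

abbreviation obs_YA :: "'z obs \<Rightarrow> real" where
  "obs_YA x \<equiv> of_bool (fst x)"

abbreviation obs_Z :: "'z obs \<Rightarrow> 'z" where
  "obs_Z x \<equiv> snd (snd x)"

definition bern :: "real \<Rightarrow> bool \<Rightarrow> real" where
  "bern q y = (if y then q else 1 - q)"

definition obs_space :: "'z measure \<Rightarrow> 'z obs measure" where
  "obs_space \<nu> = count_space UNIV \<Otimes>\<^sub>M (count_space UNIV \<Otimes>\<^sub>M \<nu>)"

definition full_law :: "'z measure \<Rightarrow> ('z \<Rightarrow> real) \<Rightarrow> ('z \<Rightarrow> real) \<Rightarrow> ('z \<Rightarrow> real) \<Rightarrow> (bool \<times> bool \<times> 'z) measure" where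
  \<comment> \<open>The joint law of \<open>(Y, A, Z)\<close>; the product of the two Bernoulli factors is the conditional
     independence of \<open>Y\<close> and \<open>A\<close> given \<open>Z\<close>.\<close>
  "full_law \<nu> a b f =
     density (obs_space \<nu>) (\<lambda>(y, \<alpha>, z). ennreal (bern (b z) y * bern (1 / a z) \<alpha> * f z))"

definition law :: "'z measure \<Rightarrow> ('z \<Rightarrow> real) \<Rightarrow> ('z \<Rightarrow> real) \<Rightarrow> ('z \<Rightarrow> real) \<Rightarrow> 'z obs measure" where
  "law \<nu> a b f = distr (full_law \<nu> a b f) (obs_space \<nu>) (\<lambda>(y, \<alpha>, z). (y \<and> \<alpha>, \<alpha>, z))"

text \<open>Elements of \<open>L\<^sub>2(\<nu>)\<close> are represented by functions, equality being almost everywhere equality.\<close>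

definition L2_subspace :: "'z measure \<Rightarrow> ('z \<Rightarrow> real) set \<Rightarrow> bool" where
  "L2_subspace \<nu> L \<longleftrightarrow>
     (\<forall>u\<in>L. u \<in> borel_measurable \<nu> \<and> integrable \<nu> (\<lambda>z. (u z)\<^sup>2)) \<and>
     (\<lambda>z. 0) \<in> L \<and>
     (\<forall>u\<in>L. \<forall>v\<in>L. (\<lambda>z. u z + v z) \<in> L) \<and>
     (\<forall>c. \<forall>u\<in>L. (\<lambda>z. c * u z) \<in> L)"

definition L2_basis :: "'z measure \<Rightarrow> ('z \<Rightarrow> real) set \<Rightarrow> nat \<Rightarrow> (nat \<Rightarrow> 'z \<Rightarrow> real) \<Rightarrow> bool" where
  "L2_basis \<nu> L k e \<longleftrightarrow>
     (\<forall>i<k. e i \<in> L) \<and>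
     (\<forall>c::nat \<Rightarrow> real. (AE z in \<nu>. (\<Sum>i<k. c i * e i z) = 0) \<longrightarrow> (\<forall>i<k. c i = 0)) \<and>
     (\<forall>u\<in>L. \<exists>c::nat \<Rightarrow> real. AE z in \<nu>. u z = (\<Sum>i<k. c i * e i z))"

definition orth_proj :: "'z measure \<Rightarrow> ('z \<Rightarrow> real) \<Rightarrow> ('z \<Rightarrow> real) set \<Rightarrow> ('z \<Rightarrow> real) \<Rightarrow> 'z \<Rightarrow> real" where
  \<comment> \<open>A version of the orthogonal projection of \<open>h\<close> onto \<open>L\<close> in \<open>L\<^sub>2\<close> of the measure with
     \<open>\<nu>\<close>-density \<open>w\<close>.\<close>
  "orth_proj \<nu> w L h = (SOME u. u \<in> L \<and> (\<forall>v\<in>L. (\<integral>z. (h z - u z) * v z * w z \<partial>\<nu>) = 0))"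

definition gram :: "'z measure \<Rightarrow> ('z \<Rightarrow> real) \<Rightarrow> nat \<Rightarrow> (nat \<Rightarrow> 'z \<Rightarrow> real) \<Rightarrow> real mat" where
  "gram \<nu> w k e = Matrix.mat k k (\<lambda>(i, j). \<integral>z. e i z * e j z * w z \<partial>\<nu>)"

definition proj_kernel ::
  "'z measure \<Rightarrow> ('z \<Rightarrow> real) \<Rightarrow> nat \<Rightarrow> (nat \<Rightarrow> 'z \<Rightarrow> real) \<Rightarrow> 'z \<Rightarrow> 'z \<Rightarrow> real" where
  "proj_kernel \<nu> w k e z1 z2 =
     (\<Sum>i<k. \<Sum>j<k. the (mat_inverse (gram \<nu> w k e)) $$ (i, j) * e i z1 * e j z2)"

definition weight :: "('z \<Rightarrow> real) \<Rightarrow> ('z \<Rightarrow> real) \<Rightarrow> ('z \<Rightarrow> real) \<Rightarrow> ('z \<Rightarrow> real) \<Rightarrow> 'z \<Rightarrow> real" where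
  \<comment> \<open>\<open>au\<close> and \<open>bu\<close> are the underlined \<open>a\<close> and \<open>b\<close>, and \<open>f / a\<close> is \<open>g\<close>.\<close>
  "weight au bu a f z = au z * bu z * (f z / a z)"

definition tilde :: "'z measure \<Rightarrow> ('z \<Rightarrow> real) \<Rightarrow> ('z \<Rightarrow> real) set \<Rightarrow>
    ('z \<Rightarrow> real) \<Rightarrow> ('z \<Rightarrow> real) \<Rightarrow> ('z \<Rightarrow> real) \<Rightarrow> 'z \<Rightarrow> real" where
  \<comment> \<open>Solves \<open>(tilde - hat) / und = orth_proj ((h - hat) / und)\<close> for \<open>tilde\<close>.\<close>
  "tilde \<nu> w L hat und h z = hat z + und z * orth_proj \<nu> w L (\<lambda>z. (h z - hat z) / und z) z"

definition atilde where
  "atilde \<nu> ahat au bu L a f = tilde \<nu> (weight au bu a f) L ahat au a"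

definition btilde where
  "btilde \<nu> bhat au bu L a b f = tilde \<nu> (weight au bu a f) L bhat bu b"

definition score :: "('z \<Rightarrow> real) \<Rightarrow> ('z \<Rightarrow> real) \<Rightarrow> 'z obs \<Rightarrow> real" where
  \<comment> \<open>\<open>A a(Z) (Y - b(Z)) + b(Z)\<close>, where \<open>A Y = Y A\<close> is the observed first component.\<close>
  "score a b x = a (obs_Z x) * (obs_YA x - obs_A x * b (obs_Z x)) + b (obs_Z x)"

definition chi_tilde :: "'z measure \<Rightarrow> ('z \<Rightarrow> real) \<Rightarrow> ('z \<Rightarrow> real) \<Rightarrow> ('z \<Rightarrow> real) \<Rightarrow> ('z \<Rightarrow> real) \<Rightarrow>
    ('z \<Rightarrow> real) set \<Rightarrow> ('z \<Rightarrow> real) \<Rightarrow> ('z \<Rightarrow> real) \<Rightarrow> ('z \<Rightarrow> real) \<Rightarrow> real" where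
  "chi_tilde \<nu> ahat au bhat bu L a b f =
     (\<integral>x. score (atilde \<nu> ahat au bu L a f) (btilde \<nu> bhat au bu L a b f) x \<partial>law \<nu> a b f)"

definition chi_tilde_1 :: "'z measure \<Rightarrow> ('z \<Rightarrow> real) \<Rightarrow> ('z \<Rightarrow> real) \<Rightarrow> ('z \<Rightarrow> real) \<Rightarrow> ('z \<Rightarrow> real) \<Rightarrow>
    ('z \<Rightarrow> real) set \<Rightarrow> ('z \<Rightarrow> real) \<Rightarrow> ('z \<Rightarrow> real) \<Rightarrow> ('z \<Rightarrow> real) \<Rightarrow> 'z obs \<Rightarrow> real" where
  "chi_tilde_1 \<nu> ahat au bhat bu L a b f x =
     score (atilde \<nu> ahat au bu L a f) (btilde \<nu> bhat au bu L a b f) x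
     - (\<integral>z. atilde \<nu> ahat au bu L a f z * btilde \<nu> bhat au bu L a b f z * (f z / a z) \<partial>\<nu>)"

text \<open>Functions of \<open>(X\<^sub>1, \<dots>, X\<^sub>m)\<close> are functions of \<open>x :: nat \<Rightarrow> 'z obs\<close>, integrated with respect to
  the product measure over the index set \<open>{1..m}\<close>.\<close>

definition iid :: "nat \<Rightarrow> 'x measure \<Rightarrow> (nat \<Rightarrow> 'x) measure" where
  "iid m P = (\<Pi>\<^sub>M i\<in>{1..m}. P)"

definition sigma_of :: "nat \<Rightarrow> 'x measure \<Rightarrow> nat set \<Rightarrow> (nat \<Rightarrow> 'x) measure" where
  \<comment> \<open>The sigma-algebra generated by \<open>X\<^sub>i\<close>, \<open>i \<in> B\<close>.\<close>
  "sigma_of m P B = vimage_algebra (space (iid m P)) (\<lambda>x. restrict x B) (\<Pi>\<^sub>M i\<in>B. P)"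

definition degenerate_part :: "'x measure \<Rightarrow> nat \<Rightarrow> ((nat \<Rightarrow> 'x) \<Rightarrow> real) \<Rightarrow> (nat \<Rightarrow> 'x) \<Rightarrow> real" where
  "degenerate_part P m h x =
     (\<Sum>B\<in>Pow {1..m}. (-1) ^ (m - card B) * real_cond_exp (iid m P) (sigma_of m P B) h x)"

text \<open>Existence of the \<open>n\<close>-th derivative at a point, whose value is then \<open>(deriv ^^ n) \<phi> t\<close>.\<close>

primrec nth_differentiable :: "nat \<Rightarrow> (real \<Rightarrow> real) \<Rightarrow> real \<Rightarrow> bool" where
  "nth_differentiable 0 \<phi> t \<longleftrightarrow> True"
| "nth_differentiable (Suc n) \<phi> t \<longleftrightarrow>
     (\<forall>\<^sub>F s in nhds t. nth_differentiable n \<phi> s) \<and> (deriv ^^ n) \<phi> differentiable at t"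

definition same_nth_deriv :: "nat \<Rightarrow> real \<Rightarrow> (real \<Rightarrow> real) \<Rightarrow> (real \<Rightarrow> real) \<Rightarrow> bool" where
  "same_nth_deriv n t \<phi> \<psi> \<longleftrightarrow>
     nth_differentiable n \<phi> t \<and> nth_differentiable n \<psi> t \<and> (deriv ^^ n) \<phi> t = (deriv ^^ n) \<psi> t"

definition influence_functions ::
  "'z measure \<Rightarrow> (('z \<Rightarrow> real) \<Rightarrow> ('z \<Rightarrow> real) \<Rightarrow> ('z \<Rightarrow> real) \<Rightarrow> real) \<Rightarrow>
   ('z \<Rightarrow> real) \<Rightarrow> ('z \<Rightarrow> real) \<Rightarrow> ('z \<Rightarrow> real) \<Rightarrow> (nat \<Rightarrow> (nat \<Rightarrow> 'z obs) \<Rightarrow> real) \<Rightarrow> bool" where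
  \<comment> \<open>\<open>infl i\<close> is the \<open>i\<close>-th order influence function, \<open>i \<ge> 1\<close>, at \<open>(a, b, f)\<close> of the functional \<open>F\<close>.
     The perturbed parameters define a law of the model only for small \<open>t\<close>, which suffices
     for derivatives at 0.\<close>
  "influence_functions \<nu> F a b f infl \<longleftrightarrow>
     (\<forall>m j da db df. 1 \<le> j \<longrightarrow> j \<le> m \<longrightarrow>
        bounded_meas \<nu> da \<longrightarrow> bounded_meas \<nu> db \<longrightarrow> bounded_meas \<nu> df \<longrightarrow>
        (\<integral>z. df z * f z \<partial>\<nu>) = 0 \<longrightarrow>
        (let a' = (\<lambda>t z. a z + t * da z);
             b' = (\<lambda>t z. b z + t * db z);
             f' = (\<lambda>t z. f z * (1 + t * df z))
         in same_nth_deriv j 0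
              (\<lambda>t. F (a' t) (b' t) (f' t))
              (\<lambda>t. \<Sum>i=1..m. 1 / fact i * (\<integral>x. infl i x \<partial>iid i (law \<nu> (a' t) (b' t) (f' t))))))"

definition Y_tilde where
  "Y_tilde \<nu> bhat au bu L a b f x =
     (obs_YA x - obs_A x * btilde \<nu> bhat au bu L a b f (obs_Z x)) * au (obs_Z x)"

definition A_tilde where
  "A_tilde \<nu> ahat au bu L a f x =
     (obs_A x * atilde \<nu> ahat au bu L a f (obs_Z x) - 1) * bu (obs_Z x)"

definition A_und :: "('z \<Rightarrow> real) \<Rightarrow> ('z \<Rightarrow> real) \<Rightarrow> 'z obs \<Rightarrow> real" where
  "A_und au bu x = obs_A x * au (obs_Z x) * bu (obs_Z x)"

end

theory Submission
  imports Defs "Jordan_Normal_Form.Determinant"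
begin

text \<open>
Fix a law \<open>P\<close> of the model and let \<open>P'\<close> be another one, with Gram matrix \<open>C' = C + M\<close>. Integrating the
degenerate part of \<open>h\<close> against \<open>P'\<^sup>m\<close> gives \<open>(P' - P)\<^sup>m h\<close>, and for the chain of projection kernels this
is a matrix product: with \<open>\<alpha>\<close> and \<open>\<beta>\<close> the \<open>(P' - P)\<close>-integrals of \<open>A_tilde * e\<close> and \<open>Y_tilde * e\<close>, the
term of order \<open>i\<close> contributes \<open>(-1)\<^bsup>i-1\<^esup> \<alpha> C\<^bsup>-1\<^esup> (M C\<^bsup>-1\<^esup>)\<^bsup>i-2\<^esup> \<beta>\<close>. On the other hand the
defining orthogonality relations give \<open>chi_tilde P' - P' score = - \<alpha> C'\<^bsup>-1\<^esup> \<beta>\<close> exactly. So the sum of the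
influence functions is a partial Neumann sum of \<open>(C + M)\<^bsup>-1\<^esup>\<close>, whose remainder is a product of \<open>m + 1\<close>
factors that vanish at \<open>P' = P\<close>. Along a path all these quantities are real analytic in \<open>t\<close>, so the
remainder is \<open>O(t\<^bsup>m+1\<^esup>)\<close> with vanishing derivatives up to order \<open>m\<close>.
\<close>

section \<open>Degenerate parts and product measures\<close>

text \<open>Two obstacles shape the proof beyond the algebra. First,
  \<open>nth_differentiable\<close> asks for the lower derivatives on a whole neighbourhood of 0, so
  a bound on the size of the remainder would not be enough. Every quantity is therefore carried as a
  convergent power series together with a count of its vanishing coefficients. This is possible
  because a path is affine in \<open>a\<close> and \<open>b\<close>, with density affine in
  \<open>t\<close>: the only reciprocals that occur are \<open>1 / (a + t * da)\<close> and the
  inverse of the Gram determinant. Second, functions in \<open>L\<close> are only square integrable,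
  so the chain of kernels may be unbounded, and its conditional expectations are known only almost
  everywhere under the original law. Expanding each kernel in the basis gives a finite sum of
  products of functions of separate observations. Integrability, conditioning and integration under
  another law then reduce to integrals over one observation, and absolute continuity transfers the
  almost-everywhere identities.\<close>

lemma sets_iid: "sets Q = sets P \<Longrightarrow> sets (iid n Q) = sets (iid n P)"
  unfolding iid_def by (rule sets_PiM_cong) auto

text \<open>Identities between conditional expectations hold only almost everywhere under
  \<open>iid n P\<close>, but are needed under \<open>iid n Q\<close>. The product of the
  coordinatewise Radon-Nikodym derivatives is a density of one product measure with respect to the
  other.\<close>

lemma absolutely_continuous_iid:
  assumes P: "prob_space P" and Q: "prob_space Q"
    and sets_eq: "sets Q = sets P" and ac: "absolutely_continuous P Q"
  shows "absolutely_continuous (iid n P) (iid n Q)"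
proof -
  interpret P: prob_space P by fact
  interpret Q: prob_space Q by fact
  interpret PP: product_sigma_finite "\<lambda>_. P" by standard
  interpret QQ: product_sigma_finite "\<lambda>_. Q" by standard
  define r where "r = RN_deriv P Q"
  have r[measurable]: "r \<in> borel_measurable P" by (simp add: r_def)
  have Q_eq: "density P r = Q" unfolding r_def
    by (rule P.density_RN_deriv[OF ac]) (rule sets_eq)
  have iid_Q: "density (PiM {1..n} (\<lambda>_. P)) (\<lambda>x. \<Prod>i\<in>{1..n}. r (x i)) = PiM {1..n} (\<lambda>_. Q)"
  proof (rule QQ.PiM_eqI)
    show "sets (density (PiM {1..n} (\<lambda>_. P)) (\<lambda>x. \<Prod>i\<in>{1..n}. r (x i))) = sets (PiM {1..n} (\<lambda>_. Q))"
      unfolding sets_density by (rule sets_PiM_cong) (auto simp: sets_eq)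
    fix A assume "\<And>i. i \<in> {1..n} \<Longrightarrow> A i \<in> sets Q"
    then have A: "\<And>i. i \<in> {1..n} \<Longrightarrow> A i \<in> sets P" by (simp add: sets_eq)
    have "emeasure (density (PiM {1..n} (\<lambda>_. P)) (\<lambda>x. \<Prod>i\<in>{1..n}. r (x i))) (Pi\<^sub>E {1..n} A)
        = (\<integral>\<^sup>+x. (\<Prod>i\<in>{1..n}. r (x i)) * indicator (Pi\<^sub>E {1..n} A) x \<partial>PiM {1..n} (\<lambda>_. P))"
      by (rule emeasure_density) (measurable, auto intro!: sets_PiM_I_finite A)
    also have "\<dots> = (\<integral>\<^sup>+x. (\<Prod>i\<in>{1..n}. r (x i) * indicator (A i) (x i)) \<partial>PiM {1..n} (\<lambda>_. P))"
      by (rule nn_integral_cong)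
         (auto simp: prod.distrib indicator_def space_PiM PiE_def Pi_def prod_zero_iff)
    also have "\<dots> = (\<Prod>i\<in>{1..n}. \<integral>\<^sup>+x. r x * indicator (A i) x \<partial>P)"
      using A by (intro PP.product_nn_integral_prod) auto
    also have "\<dots> = (\<Prod>i\<in>{1..n}. emeasure Q (A i))"
      using A by (intro prod.cong refl) (subst Q_eq[symmetric], simp add: emeasure_density)
    finally show "emeasure (density (PiM {1..n} (\<lambda>_. P)) (\<lambda>x. \<Prod>i\<in>{1..n}. r (x i))) (Pi\<^sub>E {1..n} A) =
        (\<Prod>i\<in>{1..n}. emeasure Q (A i))" .
  qed auto
  then show ?thesis
    unfolding iid_def by (subst iid_Q[symmetric]) (rule absolutely_continuousI_density, measurable)
qed

lemma iid_integral_prod: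
  fixes H :: "nat \<Rightarrow> 'x \<Rightarrow> real"
  assumes P: "prob_space P" and H: "\<And>i. i \<in> {1..n} \<Longrightarrow> integrable P (H i)"
  shows "integrable (iid n P) (\<lambda>x. \<Prod>i\<in>{1..n}. H i (x i))"
    and "(\<integral>x. (\<Prod>i\<in>{1..n}. H i (x i)) \<partial>iid n P) = (\<Prod>i\<in>{1..n}. \<integral>x. H i x \<partial>P)"
proof -
  interpret P: prob_space P by fact
  interpret PP: product_sigma_finite "\<lambda>_. P" by standard
  show "integrable (iid n P) (\<lambda>x. \<Prod>i\<in>{1..n}. H i (x i))"
    unfolding iid_def by (rule PP.product_integrable_prod) (use H in auto)
  show "(\<integral>x. (\<Prod>i\<in>{1..n}. H i (x i)) \<partial>iid n P) = (\<Prod>i\<in>{1..n}. \<integral>x. H i x \<partial>P)"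
    unfolding iid_def by (rule PP.product_integral_prod) (use H in auto)
qed

lemma subalgebra_sigma_of:
  assumes "B \<subseteq> {1..n}"
  shows "subalgebra (iid n P) (sigma_of n P B)"
  unfolding subalgebra_def sigma_of_def
proof
  have "(\<lambda>x. restrict x B) \<in> measurable (iid n P) (\<Pi>\<^sub>M i\<in>B. P)"
    unfolding iid_def by (rule measurable_restrict_subset[OF assms])
  then show "sets (vimage_algebra (space (iid n P)) (\<lambda>x. restrict x B) (\<Pi>\<^sub>M i\<in>B. P)) \<subseteq> sets (iid n P)"
    by (subst sets_vimage_algebra2) (auto simp: measurable_def)
qed simp

lemma sigma_finite_sigma_of:
  assumes P: "prob_space P" and B: "B \<subseteq> {1..n}"
  shows "sigma_finite_subalgebra (iid n P) (sigma_of n P B)"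
proof -
  interpret P: prob_space P by fact
  interpret prob_space "iid n P" unfolding iid_def by (rule prob_space_PiM) (rule P)
  interpret finite_measure_subalgebra "iid n P" "sigma_of n P B"
    by standard (rule subalgebra_sigma_of[OF B])
  show ?thesis by (rule sigma_finite_subalgebra_axioms)
qed

text \<open>By independence, conditioning replaces each factor outside \<open>B\<close> by its mean.
  The sets to test against are cylinders over \<open>B\<close>, so Fubini's theorem verifies the
  characterization of conditional expectation.\<close>

lemma real_cond_exp_sigma_of_prod:
  fixes H :: "nat \<Rightarrow> 'x \<Rightarrow> real"
  assumes P: "prob_space P" and B: "B \<subseteq> {1..n}" and H: "\<And>i. i \<in> {1..n} \<Longrightarrow> integrable P (H i)"
  shows "AE x in iid n P. real_cond_exp (iid n P) (sigma_of n P B) (\<lambda>x. \<Prod>i\<in>{1..n}. H i (x i)) x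
      = (\<Prod>i\<in>{1..n}. if i \<in> B then H i (x i) else \<integral>y. H i y \<partial>P)"
proof -
  interpret P: prob_space P by fact
  interpret PP: product_sigma_finite "\<lambda>_. P" by standard
  interpret sigma_finite_subalgebra "iid n P" "sigma_of n P B"
    by (rule sigma_finite_sigma_of[OF P B])
  let ?G = "\<lambda>i y. if i \<in> B then H i y else (\<integral>y. H i y \<partial>P)"
  let ?J = "{1..n} - B"
  have G: "integrable P (?G i)" if "i \<in> {1..n}" for i
    using H[OF that] by (cases "i \<in> B") simp_all
  have finB: "finite B" using B finite_subset by auto
  have U: "{1..n} = B \<union> ?J" using B by auto
  show ?thesis
  proof (rule real_cond_exp_charact)
    show "integrable (iid n P) (\<lambda>x. \<Prod>i\<in>{1..n}. H i (x i))"
      by (rule iid_integral_prod(1)[OF P H])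
    show "integrable (iid n P) (\<lambda>x. \<Prod>i\<in>{1..n}. ?G i (x i))"
      by (rule iid_integral_prod(1)[OF P G])
    have "(\<lambda>x. restrict x B) \<in> measurable (sigma_of n P B) (\<Pi>\<^sub>M i\<in>B. P)"
      unfolding sigma_of_def
      by (rule measurable_vimage_algebra1) (use B in \<open>auto simp: iid_def space_PiM PiE_def Pi_def\<close>)
    moreover have "(\<lambda>x. \<Prod>i\<in>{1..n}. ?G i (x i)) \<in> borel_measurable (\<Pi>\<^sub>M i\<in>B. P)"
    proof (rule borel_measurable_prod)
      fix i assume i: "i \<in> {1..n}"
      show "(\<lambda>x. ?G i (x i)) \<in> borel_measurable (\<Pi>\<^sub>M i\<in>B. P)"
      proof (cases "i \<in> B")
        case True
        then have "(\<lambda>x. x i) \<in> measurable (\<Pi>\<^sub>M i\<in>B. P) P" by simp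
        with True H[OF i] show ?thesis by simp measurable
      qed simp
    qed
    ultimately have "(\<lambda>x. \<Prod>i\<in>{1..n}. ?G i (restrict x B i)) \<in> borel_measurable (sigma_of n P B)"
      by (rule measurable_compose)
    moreover have "(\<lambda>x. \<Prod>i\<in>{1..n}. ?G i (restrict x B i)) = (\<lambda>x. \<Prod>i\<in>{1..n}. ?G i (x i))"
      by (intro ext prod.cong) auto
    ultimately show "(\<lambda>x. \<Prod>i\<in>{1..n}. ?G i (x i)) \<in> borel_measurable (sigma_of n P B)"
      by simp
    fix A assume A: "A \<in> sets (sigma_of n P B)"
    then have A_iid: "A \<in> sets (iid n P)"
      using subalg by (auto simp: subalgebra_def)
    have "(\<lambda>x. restrict x B) \<in> space (iid n P) \<rightarrow> space (\<Pi>\<^sub>M i\<in>B. P)"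
      using B by (auto simp: iid_def space_PiM PiE_def Pi_def)
    from A[unfolded sigma_of_def sets_vimage_algebra2[OF this]]
    obtain A' where A': "A = (\<lambda>x. restrict x B) -` A' \<inter> space (iid n P)" by auto
    \<comment> \<open>Membership in \<open>A\<close> depends only on the coordinates in
      \<open>B\<close>, so the remaining factors integrate out. For \<open>H\<close> and for
      \<open>?G\<close> the outcome is the same, because \<open>?G i\<close> outside
      \<open>B\<close> is constant and equal to the mean of \<open>H i\<close>.\<close>
    have fold: "(\<integral>x\<in>A. (\<Prod>i\<in>{1..n}. K i (x i)) \<partial>iid n P)
        = (\<integral>x. indicator A' x * (\<Prod>i\<in>B. K i (x i)) * (\<Prod>i\<in>?J. \<integral>y. K i y \<partial>P) \<partial>PiM B (\<lambda>_. P))"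
      if K: "\<And>i. i \<in> {1..n} \<Longrightarrow> integrable P (K i)" for K :: "nat \<Rightarrow> 'x \<Rightarrow> real"
    proof -
      have int: "integrable (PiM (B \<union> ?J) (\<lambda>_. P)) (\<lambda>x. indicator A x * (\<Prod>i\<in>{1..n}. K i (x i)))"
        using integrable_mult_indicator[OF A_iid iid_integral_prod(1)[OF P K]]
        unfolding iid_def U[symmetric] by simp
      have "(\<integral>x\<in>A. (\<Prod>i\<in>{1..n}. K i (x i)) \<partial>iid n P)
          = (\<integral>x. indicator A x * (\<Prod>i\<in>{1..n}. K i (x i)) \<partial>PiM (B \<union> ?J) (\<lambda>_. P))"
        unfolding set_lebesgue_integral_def iid_def U[symmetric] by simp
      also have "\<dots> = (\<integral>x. (\<integral>y. indicator A (merge B ?J (x, y)) *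
          (\<Prod>i\<in>{1..n}. K i (merge B ?J (x, y) i)) \<partial>PiM ?J (\<lambda>_. P)) \<partial>PiM B (\<lambda>_. P))"
        by (rule PP.product_integral_fold[OF _ _ _ int]) (use finB in auto)
      also have "\<dots> = (\<integral>x. (\<integral>y. indicator A' x * (\<Prod>i\<in>B. K i (x i)) *
          (\<Prod>i\<in>?J. K i (y i)) \<partial>PiM ?J (\<lambda>_. P)) \<partial>PiM B (\<lambda>_. P))"
      proof (intro Bochner_Integration.integral_cong refl)
        fix x y assume x: "x \<in> space (PiM B (\<lambda>_. P))" and y: "y \<in> space (PiM ?J (\<lambda>_. P))"
        have "merge B ?J (x, y) \<in> space (iid n P)"
          using x y B by (auto simp: iid_def space_PiM PiE_def Pi_def merge_def extensional_def)
        moreover have "restrict (merge B ?J (x, y)) B = x"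
          using x by (auto simp: space_PiM PiE_def restrict_def merge_def extensional_def fun_eq_iff)
        ultimately have "indicator A (merge B ?J (x, y)) = (indicator A' x :: real)"
          by (simp add: A' indicator_def)
        moreover have "(\<Prod>i\<in>{1..n}. K i (merge B ?J (x, y) i)) = (\<Prod>i\<in>B. K i (x i)) * (\<Prod>i\<in>?J. K i (y i))"
          by (subst U, subst prod.union_disjoint) (use finB in \<open>auto intro!: arg_cong2[where f="(*)"] prod.cong\<close>)
        ultimately show "indicator A (merge B ?J (x, y)) * (\<Prod>i\<in>{1..n}. K i (merge B ?J (x, y) i)) =
            indicator A' x * (\<Prod>i\<in>B. K i (x i)) * (\<Prod>i\<in>?J. K i (y i))"
          by simp
      qed
      also have "\<dots> = (\<integral>x. indicator A' x * (\<Prod>i\<in>B. K i (x i)) * (\<Prod>i\<in>?J. \<integral>y. K i y \<partial>P) \<partial>PiM B (\<lambda>_. P))"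
        using PP.product_integral_prod[of ?J K] K by simp
      finally show ?thesis .
    qed
    show "(\<integral>x\<in>A. (\<Prod>i\<in>{1..n}. H i (x i)) \<partial>iid n P) = (\<integral>x\<in>A. (\<Prod>i\<in>{1..n}. ?G i (x i)) \<partial>iid n P)"
      by (subst fold[of H, OF H], assumption, subst fold[of ?G, OF G], assumption)
         (rule Bochner_Integration.integral_cong[OF refl], simp add: P.prob_space)
  qed
qed

text \<open>\<open>tensor_sum P Q n h v\<close>: \<open>h\<close> is a finite sum of products of functions of single coordinates, and
  \<open>v\<close> is the value of the product of signed measures \<open>(Q - P)\<^sup>n\<close> at \<open>h\<close>, computed termwise.\<close>

inductive tensor_sum :: "'x measure \<Rightarrow> 'x measure \<Rightarrow> nat \<Rightarrow> ((nat \<Rightarrow> 'x) \<Rightarrow> real) \<Rightarrow> real \<Rightarrow> bool"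
  for P Q n where
  prod: "(\<And>i. i \<in> {1..n} \<Longrightarrow> integrable P (H i)) \<Longrightarrow> (\<And>i. i \<in> {1..n} \<Longrightarrow> integrable Q (H i)) \<Longrightarrow>
    tensor_sum P Q n (\<lambda>x. \<Prod>i\<in>{1..n}. H i (x i)) (\<Prod>i\<in>{1..n}. (\<integral>y. H i y \<partial>Q) - (\<integral>y. H i y \<partial>P))"
| add: "tensor_sum P Q n h1 v1 \<Longrightarrow> tensor_sum P Q n h2 v2 \<Longrightarrow>
    tensor_sum P Q n (\<lambda>x. h1 x + h2 x) (v1 + v2)"

lemma tensor_sum_extend:
  assumes "tensor_sum P Q n h v" and u: "integrable P u" "integrable Q u"
  shows "tensor_sum P Q (Suc n) (\<lambda>x. h x * u (x (Suc n))) (v * ((\<integral>y. u y \<partial>Q) - (\<integral>y. u y \<partial>P)))"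
  using assms(1)
proof induction
  case (prod H)
  let ?H = "H(Suc n := u)"
  have 1: "(\<Prod>i\<in>{1..Suc n}. g i (?H i)) = (\<Prod>i\<in>{1..n}. g i (H i)) * g (Suc n) u" for g :: "nat \<Rightarrow> _ \<Rightarrow> real"
  proof -
    have "(\<Prod>i\<in>{1..Suc n}. g i (?H i)) = (\<Prod>i\<in>{1..n}. g i (?H i)) * g (Suc n) u" by simp
    also have "(\<Prod>i\<in>{1..n}. g i (?H i)) = (\<Prod>i\<in>{1..n}. g i (H i))" by (rule prod.cong) auto
    finally show ?thesis .
  qed
  have "tensor_sum P Q (Suc n) (\<lambda>x. \<Prod>i\<in>{1..Suc n}. ?H i (x i))
      (\<Prod>i\<in>{1..Suc n}. (\<integral>y. ?H i y \<partial>Q) - (\<integral>y. ?H i y \<partial>P))"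
    by (rule tensor_sum.prod) (use prod u in auto)
  then show ?case
    using 1[of "\<lambda>i v. (\<integral>y. v y \<partial>Q) - (\<integral>y. v y \<partial>P)"] 1[of "\<lambda>i v. v (x i)" for x] by simp
next
  case (add h1 v1 h2 v2)
  from tensor_sum.add[OF add.IH] show ?case by (simp add: algebra_simps)
qed

lemma tensor_sum_zero: "n > 0 \<Longrightarrow> tensor_sum P Q n (\<lambda>x. 0) 0"
  using tensor_sum.prod[of n P "\<lambda>_ _. 0" Q] by (simp add: power_0_left)

lemma tensor_sum_sum:
  assumes "n > 0" "finite S" "\<And>s. s \<in> S \<Longrightarrow> tensor_sum P Q n (h s) (v s)"
  shows "tensor_sum P Q n (\<lambda>x. \<Sum>s\<in>S. h s x) (\<Sum>s\<in>S. v s)"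
  using assms(2,3) by induction (auto intro: tensor_sum_zero assms(1) tensor_sum.add)

text \<open>The constant is absorbed into the last factor of each product; this requires at least
  one coordinate, as the empty product cannot be rescaled.\<close>

lemma tensor_sum_scale:
  assumes "n > 0" "tensor_sum P Q n h v"
  shows "tensor_sum P Q n (\<lambda>x. h x * c) (v * c)"
  using assms(2)
proof induction
  case (prod H)
  from \<open>n > 0\<close> obtain k where n: "n = Suc k" by (cases n) auto
  have "tensor_sum P Q k (\<lambda>x. \<Prod>i\<in>{1..k}. H i (x i)) (\<Prod>i\<in>{1..k}. (\<integral>y. H i y \<partial>Q) - (\<integral>y. H i y \<partial>P))"
    by (rule tensor_sum.prod) (use prod n in auto)
  from tensor_sum_extend[OF this, of "\<lambda>y. H n y * c"] prod n
  show ?case by (simp add: left_diff_distrib[symmetric] mult.assoc)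
next
  case (add h1 v1 h2 v2)
  from tensor_sum.add[OF add.IH] show ?case by (simp add: algebra_simps)
qed

lemma tensor_sum_integrable:
  assumes P: "prob_space P" and "tensor_sum P Q n h v"
  shows "integrable (iid n P) h"
  using assms(2)
proof induction
  case (prod H)
  then show ?case by (intro iid_integral_prod(1)[OF P])
qed auto

text \<open>For a product, the term of index \<open>B\<close> integrates to \<open>Q\<close>-means
  on \<open>B\<close> times \<open>P\<close>-means off \<open>B\<close>, and the signed sum over
  \<open>B\<close> is the expansion of a product of differences. Sums of products follow from
  additivity of conditional expectation, valid because each summand is integrable under
  \<open>iid n P\<close>.\<close>

lemma degenerate_part_integral:
  assumes P: "prob_space P" and Q: "prob_space Q"
    and sets_eq: "sets Q = sets P" and ac: "absolutely_continuous P Q"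
    and "tensor_sum P Q n h v"
  shows "has_bochner_integral (iid n Q) (degenerate_part P n h) v"
  using assms(5)
proof induction
  case (prod H)
  let ?G = "\<lambda>B i y. if i \<in> B then H i y else (\<integral>y. H i y \<partial>P)"
  let ?h = "\<lambda>x. \<Prod>i\<in>{1..n}. H i (x i)"
  have G: "integrable Q (?G B i)" if "i \<in> {1..n}" for i B
    using prod(2)[OF that] by (cases "i \<in> B") (simp_all add: Q finite_measure.integrable_const prob_space.finite_measure)
  have "AE x in iid n P. \<forall>B\<in>Pow {1..n}. real_cond_exp (iid n P) (sigma_of n P B) ?h x = (\<Prod>i\<in>{1..n}. ?G B i (x i))"
    by (rule AE_finite_allI, simp) (rule real_cond_exp_sigma_of_prod[OF P], use prod in auto)
  \<comment> \<open>The finitely many exceptional sets are null for \<open>P\<close>; absolute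
    continuity makes them null for \<open>Q\<close>.\<close>
  then have "AE x in iid n Q. \<forall>B\<in>Pow {1..n}. real_cond_exp (iid n P) (sigma_of n P B) ?h x = (\<Prod>i\<in>{1..n}. ?G B i (x i))"
    by (rule absolutely_continuous_AE[OF sets_iid[OF sets_eq] absolutely_continuous_iid[OF P Q sets_eq ac]])
  then have ae: "AE x in iid n Q. (\<Sum>B\<in>Pow {1..n}. (-1) ^ (n - card B) * (\<Prod>i\<in>{1..n}. ?G B i (x i))) = degenerate_part P n ?h x"
    by eventually_elim (simp add: degenerate_part_def)
  have Q1: "measure Q (space Q) = 1" by (rule prob_space.prob_space[OF Q])
  have "has_bochner_integral (iid n Q) (\<lambda>x. \<Sum>B\<in>Pow {1..n}. (-1) ^ (n - card B) * (\<Prod>i\<in>{1..n}. ?G B i (x i)))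
      (\<Sum>B\<in>Pow {1..n}. (-1) ^ (n - card B) * (\<Prod>i\<in>{1..n}. \<integral>y. ?G B i y \<partial>Q))"
    by (intro has_bochner_integral_sum has_bochner_integral_mult_right)
       (unfold has_bochner_integral_iff, intro conjI iid_integral_prod[OF Q] G)
  also have "(\<Sum>B\<in>Pow {1..n}. (-1) ^ (n - card B) * (\<Prod>i\<in>{1..n}. \<integral>y. ?G B i y \<partial>Q))
     = (\<Sum>B\<in>Pow {1..n}. (-1) ^ (card {1..n} - card B) * (\<Prod>i\<in>B. \<integral>y. H i y \<partial>Q) * (\<Prod>i\<in>{1..n}-B. \<integral>y. H i y \<partial>P))"
  proof (rule sum.cong[OF refl])
    fix B assume "B \<in> Pow {1..n}"
    then have U: "{1..n} = B \<union> ({1..n} - B)" and fB: "finite B" using finite_subset by auto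
    have "(\<Prod>i\<in>{1..n}. \<integral>y. ?G B i y \<partial>Q) = (\<Prod>i\<in>B. \<integral>y. ?G B i y \<partial>Q) * (\<Prod>i\<in>{1..n}-B. \<integral>y. ?G B i y \<partial>Q)"
      by (subst U, subst prod.union_disjoint) (use fB in auto)
    also have "\<dots> = (\<Prod>i\<in>B. \<integral>y. H i y \<partial>Q) * (\<Prod>i\<in>{1..n}-B. \<integral>y. H i y \<partial>P)"
      by (auto intro!: arg_cong2[where f="(*)"] prod.cong simp: Q1)
    finally show "(-1) ^ (n - card B) * (\<Prod>i\<in>{1..n}. \<integral>y. ?G B i y \<partial>Q)
      = (-1) ^ (card {1..n} - card B) * (\<Prod>i\<in>B. \<integral>y. H i y \<partial>Q) * (\<Prod>i\<in>{1..n}-B. \<integral>y. H i y \<partial>P)"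
      by simp
  qed
  also have "\<dots> = (\<Prod>i\<in>{1..n}. (\<integral>y. H i y \<partial>Q) - (\<integral>y. H i y \<partial>P))"
    by (rule prod_diff_conv_sum'[symmetric]) simp
  finally have hb: "has_bochner_integral (iid n Q) (\<lambda>x. \<Sum>B\<in>Pow {1..n}. (-1) ^ (n - card B) * (\<Prod>i\<in>{1..n}. ?G B i (x i)))
      (\<Prod>i\<in>{1..n}. (\<integral>y. H i y \<partial>Q) - (\<integral>y. H i y \<partial>P))" .
  have "measurable (iid n Q) borel = (measurable (iid n P) borel :: ((nat \<Rightarrow> _) \<Rightarrow> real) set)"
    by (rule measurable_cong_sets[OF sets_iid[OF sets_eq] refl])
  then have "degenerate_part P n ?h \<in> borel_measurable (iid n Q)"
    unfolding degenerate_part_def[abs_def] by simp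
  with hb ae show ?case
    by (subst has_bochner_integral_cong_AE[OF _ _ ae, symmetric]) (auto dest: has_bochner_integral_implies_finite_norm simp: has_bochner_integral_iff)
next
  case (add h1 v1 h2 v2)
  have i: "integrable (iid n P) h1" "integrable (iid n P) h2"
    using add tensor_sum_integrable[OF P] by auto
  let ?E = "\<lambda>B. real_cond_exp (iid n P) (sigma_of n P B)"
  have "AE x in iid n P. \<forall>B\<in>Pow {1..n}. ?E B (\<lambda>x. h1 x + h2 x) x = ?E B h1 x + ?E B h2 x"
    by (rule AE_finite_allI)
       (auto intro!: sigma_finite_subalgebra.real_cond_exp_add sigma_finite_sigma_of[OF P] i)
  then have "AE x in iid n Q. \<forall>B\<in>Pow {1..n}. ?E B (\<lambda>x. h1 x + h2 x) x = ?E B h1 x + ?E B h2 x"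
    by (rule absolutely_continuous_AE[OF sets_iid[OF sets_eq] absolutely_continuous_iid[OF P Q sets_eq ac]])
  then have ae: "AE x in iid n Q. degenerate_part P n h1 x + degenerate_part P n h2 x = degenerate_part P n (\<lambda>x. h1 x + h2 x) x"
    by eventually_elim (simp add: degenerate_part_def ring_distribs sum.distrib)
  have "measurable (iid n Q) borel = (measurable (iid n P) borel :: ((nat \<Rightarrow> _) \<Rightarrow> real) set)"
    by (rule measurable_cong_sets[OF sets_iid[OF sets_eq] refl])
  then have "degenerate_part P n h \<in> borel_measurable (iid n Q)" for h
    unfolding degenerate_part_def[abs_def] by simp
  with has_bochner_integral_add[OF add.IH] show ?case
    by (subst has_bochner_integral_cong_AE[OF _ _ ae, symmetric]) auto
qed

section \<open>Analytic functions and vanishing orders\<close>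

text \<open>The claim concerns every point of an open set, not only 0, because each induction step
  differentiates an identity that must hold on a neighbourhood.\<close>

lemma nth_differentiable_eval_fps:
  fixes F :: "real fps"
  assumes "open S" "S \<subseteq> eball 0 (fps_conv_radius F)" "\<And>s. s \<in> S \<Longrightarrow> \<phi> s = eval_fps F s" "s \<in> S"
  shows "nth_differentiable n \<phi> s \<and> (deriv ^^ n) \<phi> s = eval_fps ((fps_deriv ^^ n) F) s"
  using assms(4)
proof (induction n arbitrary: s)
  case 0
  then show ?case by (simp add: assms(3))
next
  case (Suc n)
  let ?F = "(fps_deriv ^^ n) F"
  have "fps_conv_radius F \<le> fps_conv_radius ?F"
    by (induction n) (auto intro: order_trans fps_conv_radius_deriv)
  with Suc.prems assms(2) have "ereal (norm s) < fps_conv_radius ?F"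
    by (auto simp: eball_def intro: less_le_trans)
  then have "(eval_fps ?F has_field_derivative eval_fps (fps_deriv ?F) s) (at s)"
    by (rule has_field_derivative_eval_fps)
  moreover have ev: "\<forall>\<^sub>F u in nhds s. u \<in> S"
    by (rule eventually_nhds_in_open) (use assms Suc.prems in auto)
  then have eq: "\<forall>\<^sub>F u in nhds s. (deriv ^^ n) \<phi> u = eval_fps ?F u"
    by eventually_elim (use Suc.IH in blast)
  ultimately have D: "((deriv ^^ n) \<phi> has_field_derivative eval_fps (fps_deriv ?F) s) (at s)"
    by (subst DERIV_cong_ev[OF refl eq refl])
  from ev have "\<forall>\<^sub>F u in nhds s. nth_differentiable n \<phi> u"
    by eventually_elim (use Suc.IH in blast)
  with D show ?case
    by (auto simp: DERIV_imp_deriv real_differentiable_def)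
qed

lemma fps_nth_fps_deriv_funpow_0: "fps_nth ((fps_deriv ^^ n) F) 0 = fact n * fps_nth (F :: real fps) n"
proof (induction n arbitrary: F)
  case (Suc n)
  have "fps_nth ((fps_deriv ^^ Suc n) F) 0 = fps_nth ((fps_deriv ^^ n) (fps_deriv F)) 0"
    by (simp only: funpow_Suc_right o_apply)
  then show ?case by (simp only: Suc) (simp add: algebra_simps)
qed simp

lemma nth_deriv_has_fps_expansion:
  fixes F :: "real fps"
  assumes "\<phi> has_fps_expansion F"
  shows "nth_differentiable n \<phi> 0" "(deriv ^^ n) \<phi> 0 = fact n * fps_nth F n"
proof -
  from assms obtain S where S: "open S" "0 \<in> S" "\<And>s. s \<in> S \<Longrightarrow> eval_fps F s = \<phi> s"
    by (auto simp: has_fps_expansion_def eventually_nhds)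
  let ?S = "S \<inter> eball 0 (fps_conv_radius F)"
  have "0 \<in> ?S" using assms S by (simp add: has_fps_expansion_def zero_ereal_def)
  with S have "nth_differentiable n \<phi> 0 \<and> (deriv ^^ n) \<phi> 0 = eval_fps ((fps_deriv ^^ n) F) 0"
    by (intro nth_differentiable_eval_fps[of ?S]) auto
  then show "nth_differentiable n \<phi> 0" "(deriv ^^ n) \<phi> 0 = fact n * fps_nth F n"
    by (simp_all add: eval_fps_at_0 fps_nth_fps_deriv_funpow_0)
qed

text \<open>Order 0 means just analytic at 0. Keeping analyticity inside the notion lets one
  calculus of orders deliver both the existence of all derivatives and the vanishing of the low
  ones.\<close>

definition analytic_order_ge :: "nat \<Rightarrow> (real \<Rightarrow> real) \<Rightarrow> bool" where
  "analytic_order_ge N \<phi> \<longleftrightarrow> (\<exists>F. \<phi> has_fps_expansion F \<and> (\<forall>n<N. fps_nth F n = 0))"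

lemma analytic_order_ge_const: "analytic_order_ge 0 (\<lambda>t. c)"
  unfolding analytic_order_ge_def by (auto intro!: exI[of _ "fps_const c"])

lemma analytic_order_ge_zero: "analytic_order_ge N (\<lambda>t. 0)"
  unfolding analytic_order_ge_def by (auto intro!: exI[of _ 0])

lemma analytic_order_ge_ident: "analytic_order_ge 1 (\<lambda>t. t)"
  unfolding analytic_order_ge_def by (auto intro!: exI[of _ fps_X] has_fps_expansion_fps_X)

lemma analytic_order_ge_mono: "analytic_order_ge N \<phi> \<Longrightarrow> M \<le> N \<Longrightarrow> analytic_order_ge M \<phi>"
  unfolding analytic_order_ge_def by (meson less_le_trans)

lemma analytic_order_ge_add:
  "analytic_order_ge N \<phi> \<Longrightarrow> analytic_order_ge N \<psi> \<Longrightarrow> analytic_order_ge N (\<lambda>t. \<phi> t + \<psi> t)"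
  unfolding analytic_order_ge_def by (force intro: has_fps_expansion_add)

lemma analytic_order_ge_mult:
  assumes "analytic_order_ge N \<phi>" "analytic_order_ge M \<psi>"
  shows "analytic_order_ge (N + M) (\<lambda>t. \<phi> t * \<psi> t)"
proof -
  from assms obtain F G where F: "\<phi> has_fps_expansion F" "\<And>n. n < N \<Longrightarrow> fps_nth F n = 0"
    and G: "\<psi> has_fps_expansion G" "\<And>n. n < M \<Longrightarrow> fps_nth G n = 0"
    by (auto simp: analytic_order_ge_def)
  have "fps_nth (F * G) n = 0" if "n < N + M" for n
    unfolding fps_mult_nth
  proof (rule sum.neutral, rule ballI)
    fix i assume "i \<in> {0..n}"
    then have "i < N \<or> n - i < M" using that by auto
    then show "fps_nth F i * fps_nth G (n - i) = 0" using F G by auto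
  qed
  then show ?thesis
    unfolding analytic_order_ge_def using has_fps_expansion_mult[OF F(1) G(1)] by blast
qed

lemma analytic_order_ge_mult0:
  "analytic_order_ge 0 \<phi> \<Longrightarrow> analytic_order_ge N \<psi> \<Longrightarrow> analytic_order_ge N (\<lambda>t. \<phi> t * \<psi> t)"
  using analytic_order_ge_mult[of 0 \<phi> N \<psi>] by simp

lemma analytic_order_ge_minus: "analytic_order_ge N \<phi> \<Longrightarrow> analytic_order_ge N (\<lambda>t. - \<phi> t)"
  using analytic_order_ge_mult0[OF analytic_order_ge_const[of "-1"]] by simp

lemma analytic_order_ge_diff:
  "analytic_order_ge N \<phi> \<Longrightarrow> analytic_order_ge N \<psi> \<Longrightarrow> analytic_order_ge N (\<lambda>t. \<phi> t - \<psi> t)"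
  using analytic_order_ge_add[OF _ analytic_order_ge_minus] by simp

lemma analytic_order_ge_sum:
  "(\<And>s. s \<in> S \<Longrightarrow> analytic_order_ge N (\<phi> s)) \<Longrightarrow> analytic_order_ge N (\<lambda>t. \<Sum>s\<in>S. \<phi> s t)"
  by (induction S rule: infinite_finite_induct) (auto intro: analytic_order_ge_zero analytic_order_ge_add)

lemma analytic_order_ge_prod:
  "(\<And>s. s \<in> S \<Longrightarrow> analytic_order_ge 0 (\<phi> s)) \<Longrightarrow> analytic_order_ge 0 (\<lambda>t. \<Prod>s\<in>S. \<phi> s t)"
  by (induction S rule: infinite_finite_induct) (auto intro: analytic_order_ge_const analytic_order_ge_mult0)

lemma analytic_order_ge_inverse:
  assumes "analytic_order_ge 0 \<phi>" "\<phi> 0 \<noteq> 0"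
  shows "analytic_order_ge 0 (\<lambda>t. inverse (\<phi> t))"
proof -
  from assms obtain F where F: "\<phi> has_fps_expansion F" by (auto simp: analytic_order_ge_def)
  have "fps_nth F 0 \<noteq> 0"
    using nth_deriv_has_fps_expansion(2)[OF F, of 0] assms(2) by simp
  from has_fps_expansion_inverse[OF F this] show ?thesis
    by (auto simp: analytic_order_ge_def)
qed

text \<open>This is how orthogonality at the original law, which makes a quantity vanish at
  \<open>t = 0\<close>, turns into one order of \<open>t\<close>.\<close>

lemma analytic_order_ge_vanish:
  assumes "analytic_order_ge 0 \<phi>" "\<phi> 0 = 0"
  shows "analytic_order_ge 1 \<phi>"
proof -
  from assms obtain F where F: "\<phi> has_fps_expansion F" by (auto simp: analytic_order_ge_def)
  have "fps_nth F 0 = 0"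
    using nth_deriv_has_fps_expansion(2)[OF F, of 0] assms(2) by simp
  with F show ?thesis by (auto simp: analytic_order_ge_def)
qed

text \<open>Closed forms along a path are available only while the perturbed parameters stay in the
  model, that is for \<open>t\<close> near 0.\<close>

lemma analytic_order_ge_cong:
  assumes "analytic_order_ge N \<phi>" "\<forall>\<^sub>F t in nhds 0. \<phi> t = \<psi> t"
  shows "analytic_order_ge N \<psi>"
proof -
  have "\<psi> has_fps_expansion F" if "\<phi> has_fps_expansion F" for F
  proof -
    from that have "\<forall>\<^sub>F t in nhds 0. eval_fps F t = \<phi> t" by (simp add: has_fps_expansion_def)
    with assms(2) have "\<forall>\<^sub>F t in nhds 0. eval_fps F t = \<psi> t" by eventually_elim simp
    with that show ?thesis by (simp add: has_fps_expansion_def)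
  qed
  with assms(1) show ?thesis by (auto simp: analytic_order_ge_def)
qed

lemma analytic_order_ge_det:
  fixes A :: "real \<Rightarrow> real mat"
  assumes "\<And>t. A t \<in> carrier_mat n n"
    and "\<And>i j. i < n \<Longrightarrow> j < n \<Longrightarrow> analytic_order_ge 0 (\<lambda>t. A t $$ (i, j))"
  shows "analytic_order_ge 0 (\<lambda>t. Determinant.det (A t))"
  unfolding det_def'[OF assms(1)]
  by (intro analytic_order_ge_sum analytic_order_ge_mult0 analytic_order_ge_const analytic_order_ge_prod assms(2))
     (auto simp: permutes_in_image)

text \<open>Cofactors are signed determinants of minors, hence polynomials in the entries. With
  Cramer's rule this yields analyticity of the solution of the moving Gram system.\<close>

lemma analytic_order_ge_adj_mat:
  fixes A :: "real \<Rightarrow> real mat"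
  assumes A: "\<And>t. A t \<in> carrier_mat n n"
    and an: "\<And>i j. i < n \<Longrightarrow> j < n \<Longrightarrow> analytic_order_ge 0 (\<lambda>t. A t $$ (i, j))"
    and ij: "i < n" "j < n"
  shows "analytic_order_ge 0 (\<lambda>t. adj_mat (A t) $$ (i, j))"
proof -
  have "adj_mat (A t) $$ (i, j) = (-1) ^ (j + i) * Determinant.det (mat_delete (A t) j i)" for t
    using A[of t] ij by (auto simp: adj_mat_def cofactor_def)
  moreover have "analytic_order_ge 0 (\<lambda>t. Determinant.det (mat_delete (A t) j i))"
  proof (rule analytic_order_ge_det[where n = "n - 1"])
    show "mat_delete (A t) j i \<in> carrier_mat (n - 1) (n - 1)" for t
      using mat_delete_carrier[OF A] by blast
    fix i' j' assume "i' < n - 1" "j' < n - 1"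
    then show "analytic_order_ge 0 (\<lambda>t. mat_delete (A t) j i $$ (i', j'))"
      using A by (auto simp: mat_delete_def intro!: an simp: carrier_matD[OF A])
  qed
  ultimately show ?thesis
    by (simp add: analytic_order_ge_mult0 analytic_order_ge_const)
qed

text \<open>The constant \<open>c\<close> affects only the coefficient of order 0, which
  \<open>0 < j\<close> excludes, and \<open>\<rho>\<close> has no coefficient of order
  \<open>j\<close>. The constant is present because the first influence function is centred while
  the functional is not.\<close>

lemma same_nth_deriv_analytic:
  assumes "analytic_order_ge 0 \<psi>" "analytic_order_ge N \<rho>" "0 < j" "j < N"
    and ev: "\<forall>\<^sub>F t in nhds 0. \<phi> t = c + \<psi> t + \<rho> t"
  shows "same_nth_deriv j 0 \<phi> \<psi>"
proof -
  from assms obtain F G where F: "\<psi> has_fps_expansion F"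
    and G: "\<rho> has_fps_expansion G" "fps_nth G j = 0"
    by (auto simp: analytic_order_ge_def)
  have "(\<lambda>t. c + \<psi> t + \<rho> t) has_fps_expansion (fps_const c + F + G)"
    by (intro has_fps_expansion_add F G has_fps_expansion_const)
  then have conv: "fps_conv_radius (fps_const c + F + G) > 0"
    and "\<forall>\<^sub>F t in nhds 0. eval_fps (fps_const c + F + G) t = c + \<psi> t + \<rho> t"
    by (auto simp: has_fps_expansion_def)
  from this(2) ev have "\<forall>\<^sub>F t in nhds 0. eval_fps (fps_const c + F + G) t = \<phi> t"
    by eventually_elim simp
  with conv have "\<phi> has_fps_expansion (fps_const c + F + G)"
    by (simp add: has_fps_expansion_def)
  from nth_deriv_has_fps_expansion[OF this, of j] nth_deriv_has_fps_expansion[OF F, of j]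
  show ?thesis using G \<open>0 < j\<close> by (simp add: same_nth_deriv_def)
qed

section \<open>The model and its laws\<close>

lemma bounded_meas_const: "bounded_meas \<nu> (\<lambda>z. c)"
  by (auto simp: bounded_meas_def)

lemma bounded_meas_add:
  assumes "bounded_meas \<nu> u" "bounded_meas \<nu> v"
  shows "bounded_meas \<nu> (\<lambda>z. u z + v z)"
proof -
  from assms obtain M N where "\<forall>z\<in>space \<nu>. \<bar>u z\<bar> \<le> M" "\<forall>z\<in>space \<nu>. \<bar>v z\<bar> \<le> N"
    by (auto simp: bounded_meas_def)
  then have "\<forall>z\<in>space \<nu>. \<bar>u z + v z\<bar> \<le> M + N"
    by (meson abs_triangle_ineq add_mono order_trans)
  with assms show ?thesis by (auto simp: bounded_meas_def)
qed

lemma bounded_meas_mult: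
  assumes "bounded_meas \<nu> u" "bounded_meas \<nu> v"
  shows "bounded_meas \<nu> (\<lambda>z. u z * v z)"
proof -
  from assms obtain M N where "\<forall>z\<in>space \<nu>. \<bar>u z\<bar> \<le> M" "\<forall>z\<in>space \<nu>. \<bar>v z\<bar> \<le> N"
    by (auto simp: bounded_meas_def)
  then have "\<forall>z\<in>space \<nu>. \<bar>u z * v z\<bar> \<le> \<bar>M\<bar> * \<bar>N\<bar>"
    by (fastforce simp: abs_mult intro!: mult_mono)
  with assms show ?thesis by (auto simp: bounded_meas_def)
qed

lemma bounded_meas_diff:
  "bounded_meas \<nu> u \<Longrightarrow> bounded_meas \<nu> v \<Longrightarrow> bounded_meas \<nu> (\<lambda>z. u z - v z)"
  using bounded_meas_add[of \<nu> u "\<lambda>z. (-1) * v z"] bounded_meas_mult[OF bounded_meas_const, of \<nu> v "-1"] by simp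

lemma bounded_meas_inverse:
  assumes "u \<in> borel_measurable \<nu>" "bounded_away \<nu> {0<..} u"
  shows "bounded_meas \<nu> (\<lambda>z. 1 / u z)"
proof -
  from assms obtain l where l: "l > 0" "\<And>z. z \<in> space \<nu> \<Longrightarrow> l \<le> u z"
    by (auto simp: bounded_away_def)
  then have "\<bar>1 / u z\<bar> \<le> 1 / l" if "z \<in> space \<nu>" for z
    using l(2)[OF that] by (auto simp: frac_le)
  with assms show ?thesis by (auto simp: bounded_meas_def)
qed

lemma bounded_meas_integrable_mult:
  assumes "bounded_meas \<nu> u" "integrable \<nu> v"
  shows "integrable \<nu> (\<lambda>z. u z * v z)"
proof -
  from assms obtain M where M: "\<forall>z\<in>space \<nu>. \<bar>u z\<bar> \<le> M" and [measurable]: "u \<in> borel_measurable \<nu>"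
    by (auto simp: bounded_meas_def)
  have [measurable]: "v \<in> borel_measurable \<nu>" using assms by auto
  show ?thesis
  proof (rule Bochner_Integration.integrable_bound)
    show "integrable \<nu> (\<lambda>z. M * v z)" using assms by simp
    have "\<bar>u z * v z\<bar> \<le> \<bar>M * v z\<bar>" if "z \<in> space \<nu>" for z
      using M that by (auto simp: abs_mult intro!: mult_right_mono intro: order_trans[OF _ abs_ge_self])
    then show "AE z in \<nu>. norm (u z * v z) \<le> norm (M * v z)" by (auto simp del: abs_mult)
  qed simp
qed

text \<open>The class that contains \<open>L\<close> and the approximations \<open>atilde\<close>
  and \<open>btilde\<close>, none of which need be bounded. Every integrand below is at most a
  product of two such functions times bounded factors.\<close>

definition sq_int :: "'z measure \<Rightarrow> ('z \<Rightarrow> real) \<Rightarrow> bool" where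
  "sq_int \<nu> u \<longleftrightarrow> u \<in> borel_measurable \<nu> \<and> integrable \<nu> (\<lambda>z. (u z)\<^sup>2)"

lemma sq_int_mult_integrable:
  assumes "sq_int \<nu> u" "sq_int \<nu> v"
  shows "integrable \<nu> (\<lambda>z. u z * v z)"
proof (rule Bochner_Integration.integrable_bound)
  show "integrable \<nu> (\<lambda>z. (u z)\<^sup>2 + (v z)\<^sup>2)" using assms by (auto simp: sq_int_def)
  have [measurable]: "u \<in> borel_measurable \<nu>" "v \<in> borel_measurable \<nu>"
    using assms by (auto simp: sq_int_def)
  show "(\<lambda>z. u z * v z) \<in> borel_measurable \<nu>" by simp
  have "\<bar>x * y\<bar> \<le> x\<^sup>2 + y\<^sup>2" for x y :: real
  proof -
    have "2 * (\<bar>x\<bar> * \<bar>y\<bar>) \<le> x\<^sup>2 + y\<^sup>2"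
      using sum_squares_bound[of "\<bar>x\<bar>" "\<bar>y\<bar>"] by simp
    moreover have "0 \<le> \<bar>x\<bar> * \<bar>y\<bar>" by simp
    ultimately show ?thesis unfolding abs_mult by linarith
  qed
  then show "AE z in \<nu>. norm (u z * v z) \<le> norm ((u z)\<^sup>2 + (v z)\<^sup>2)" by simp
qed

lemma sq_int_bounded_mult:
  assumes "bounded_meas \<nu> u" "sq_int \<nu> v"
  shows "sq_int \<nu> (\<lambda>z. u z * v z)"
  unfolding sq_int_def
proof
  show "(\<lambda>z. u z * v z) \<in> borel_measurable \<nu>"
    using assms by (auto simp: sq_int_def bounded_meas_def)
  show "integrable \<nu> (\<lambda>z. (u z * v z)\<^sup>2)"
    using bounded_meas_integrable_mult[OF bounded_meas_mult[OF assms(1,1)], of "\<lambda>z. (v z)\<^sup>2"] assms(2)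
    by (simp add: sq_int_def power_mult_distrib power2_eq_square mult_ac)
qed

lemma sq_int_add:
  assumes "sq_int \<nu> u" "sq_int \<nu> v"
  shows "sq_int \<nu> (\<lambda>z. u z + v z)"
  using assms sq_int_mult_integrable[OF assms]
  by (auto simp: sq_int_def power2_sum mult.assoc)

lemma sq_int_diff:
  "sq_int \<nu> u \<Longrightarrow> sq_int \<nu> v \<Longrightarrow> sq_int \<nu> (\<lambda>z. u z - v z)"
  using sq_int_add[of \<nu> u "\<lambda>z. (-1) * v z"] sq_int_bounded_mult[OF bounded_meas_const, of \<nu> v "-1"] by simp

lemma (in finite_measure) bounded_meas_integrable: "bounded_meas M u \<Longrightarrow> integrable M u"
  using bounded_meas_integrable_mult[of M u "\<lambda>z. 1"] by simp

lemma (in finite_measure) bounded_meas_sq_int: "bounded_meas M u \<Longrightarrow> sq_int M u"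
  using bounded_meas_integrable[OF bounded_meas_mult, of u u]
  by (auto simp: sq_int_def power2_eq_square bounded_meas_def)

lemma (in finite_measure) sq_int_integrable: "sq_int M u \<Longrightarrow> integrable M u"
  using sq_int_mult_integrable[OF _ bounded_meas_sq_int[OF bounded_meas_const], of u 1] by simp

lemma modelD:
  assumes "model \<nu> a b f"
  shows "finite_measure \<nu>" "bounded_meas \<nu> a" "bounded_meas \<nu> b" "bounded_meas \<nu> f"
    "bounded_meas \<nu> (\<lambda>z. f z / a z)" "bounded_meas \<nu> (\<lambda>z. 1 / a z)"
    "\<And>z. z \<in> space \<nu> \<Longrightarrow> 0 < a z" "\<And>z. z \<in> space \<nu> \<Longrightarrow> 1 / a z < 1" "\<And>z. z \<in> space \<nu> \<Longrightarrow> 0 < f z"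
    "\<And>z. z \<in> space \<nu> \<Longrightarrow> 0 < b z" "\<And>z. z \<in> space \<nu> \<Longrightarrow> b z < 1"
    "(\<integral>z. f z \<partial>\<nu>) = 1"
proof -
  from assms have meas[measurable]: "a \<in> borel_measurable \<nu>" "b \<in> borel_measurable \<nu>" "f \<in> borel_measurable \<nu>"
    and f: "integrable \<nu> f" "(\<integral>z. f z \<partial>\<nu>) = 1"
    by (auto simp: model_def)
  from assms obtain l r where l: "0 < l" "r < 1" "\<And>z. z \<in> space \<nu> \<Longrightarrow> l \<le> 1 / a z \<and> 1 / a z \<le> r"
    by (auto simp: model_def bounded_away_def)
  from assms obtain l1 r1 where l1: "0 < l1" "r1 < 1" "\<And>z. z \<in> space \<nu> \<Longrightarrow> l1 \<le> b z \<and> b z \<le> r1"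
    by (auto simp: model_def bounded_away_def)
  have "\<exists>l2 r2. 0 < l2 \<and> (\<forall>z\<in>space \<nu>. l2 \<le> f z / a z \<and> f z / a z \<le> r2)"
    using assms by (auto simp: model_def bounded_away_def)
  then obtain l2 r2 where l2: "0 < l2" "\<And>z. z \<in> space \<nu> \<Longrightarrow> l2 \<le> f z / a z \<and> f z / a z \<le> r2"
    by blast
  show a0: "0 < a z" if "z \<in> space \<nu>" for z using l that by (smt (verit) zero_less_divide_1_iff)
  show a1: "1 / a z < 1" if "z \<in> space \<nu>" for z using l that by force
  show "0 < b z" "b z < 1" if "z \<in> space \<nu>" for z using l1 that by force+
  have al: "a z \<le> 1 / l" if "z \<in> space \<nu>" for z
    using l(3)[OF that] a0[OF that] l(1) by (auto simp: field_simps)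
  show "bounded_meas \<nu> a"
    using al a0 by (auto simp: bounded_meas_def intro!: exI[of _ "1 / l"] simp: abs_of_pos)
  show "bounded_meas \<nu> b"
    using l1 by (fastforce simp: bounded_meas_def intro!: exI[of _ 1])
  show g: "bounded_meas \<nu> (\<lambda>z. f z / a z)"
    using l2 by (fastforce simp: bounded_meas_def intro!: exI[of _ r2])
  show "bounded_meas \<nu> (\<lambda>z. 1 / a z)"
    using a1 a0 by (fastforce simp: bounded_meas_def intro!: exI[of _ 1])
  have "bounded_meas \<nu> (\<lambda>z. a z * (f z / a z))"
    by (intro bounded_meas_mult g \<open>bounded_meas \<nu> a\<close>)
  moreover have "a z * (f z / a z) = f z" if "z \<in> space \<nu>" for z using a0[OF that] by simp
  ultimately show "bounded_meas \<nu> f"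
    by (auto simp: bounded_meas_def)
  show f0: "0 < f z" if "z \<in> space \<nu>" for z
    using l2(2)[OF that] l2(1) a0[OF that] by (smt (verit) divide_nonpos_pos)
  have lf: "l2 \<le> f z" if "z \<in> space \<nu>" for z
  proof -
    have "f z / a z \<le> f z" using a1[OF that] f0[OF that] a0[OF that] by (simp add: field_simps)
    with l2(2)[OF that] show ?thesis by simp
  qed
  \<comment> \<open>Since \<open>a\<close> exceeds 1, \<open>f\<close> dominates
    \<open>f / a\<close> and thereby the constant \<open>l2\<close>; a positive constant below an
    integrable density forces finite total mass.\<close>
  have "integrable \<nu> (\<lambda>z. l2)"
    by (rule Bochner_Integration.integrable_bound[OF f(1)])
       (use lf l2(1) in \<open>auto intro!: AE_I2 order_trans[OF _ abs_ge_self]\<close>)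
  then have "emeasure \<nu> (space \<nu>) < \<infinity>"
    using l2(1) by (auto simp: integrable_iff_bounded ennreal_mult_less_top)
  then show "finite_measure \<nu>" by (intro finite_measureI) auto
  show "(\<integral>z. f z \<partial>\<nu>) = 1" by (rule f(2))
qed

section \<open>Integration over observations and absolute continuity of the laws\<close>

lemma has_bochner_integral_count_pair:
  fixes h :: "'c::finite \<times> 'z \<Rightarrow> real"
  assumes N: "sigma_finite_measure N" and h: "\<And>c. has_bochner_integral N (\<lambda>z. h (c, z)) (I c)"
  shows "has_bochner_integral (count_space UNIV \<Otimes>\<^sub>M N) h (\<Sum>c\<in>UNIV. I c)"
proof -
  interpret N: sigma_finite_measure N by fact
  interpret C: sigma_finite_measure "count_space (UNIV :: 'c set)"
    by (rule sigma_finite_measure_count_space_finite) simp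
  interpret pair_sigma_finite "count_space (UNIV :: 'c set)" N ..
  have m: "h \<in> borel_measurable (count_space UNIV \<Otimes>\<^sub>M N)"
    by (rule measurable_pair_measure_countable1) (use h in \<open>auto simp: has_bochner_integral_iff\<close>)
  have int: "integrable (count_space UNIV \<Otimes>\<^sub>M N) h"
    by (rule Fubini_integrable[OF m])
       (use h in \<open>auto simp: has_bochner_integral_iff intro!: integrable_count_space\<close>)
  have "(\<integral>p. h p \<partial>(count_space UNIV \<Otimes>\<^sub>M N)) = (\<integral>c. (\<integral>z. h (c, z) \<partial>N) \<partial>count_space UNIV)"
    by (rule integral_fst'[OF int, symmetric])
  also have "\<dots> = (\<Sum>c\<in>UNIV. I c)"
    by (subst lebesgue_integral_count_space_finite) (use h in \<open>auto simp: has_bochner_integral_iff\<close>)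
  finally show ?thesis using int by (simp add: has_bochner_integral_iff)
qed

lemma measurable_obs:
  assumes "\<And>y \<alpha>. (\<lambda>z. h (y, \<alpha>, z)) \<in> measurable \<nu> K"
  shows "h \<in> measurable (obs_space \<nu>) K"
  unfolding obs_space_def
  by (intro measurable_pair_measure_countable1) (use assms in auto)

lemma has_bochner_integral_obs:
  fixes h :: "'z obs \<Rightarrow> real"
  assumes \<nu>: "finite_measure \<nu>" and h: "\<And>y \<alpha>. integrable \<nu> (\<lambda>z. h (y, \<alpha>, z))"
  shows "has_bochner_integral (obs_space \<nu>) h (\<Sum>y\<in>UNIV. \<Sum>\<alpha>\<in>UNIV. \<integral>z. h (y, \<alpha>, z) \<partial>\<nu>)"
proof -
  interpret finite_measure \<nu> by fact
  interpret C: finite_measure "count_space (UNIV :: bool set)"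
    by (rule finite_measure_count_space) simp
  interpret pair_sigma_finite "count_space (UNIV :: bool set)" \<nu> ..
  have "sigma_finite_measure \<nu>" ..
  moreover have "sigma_finite_measure (count_space (UNIV :: bool set) \<Otimes>\<^sub>M \<nu>)" ..
  ultimately show ?thesis
    unfolding obs_space_def
    by (intro has_bochner_integral_count_pair sigma_finite_measure_axioms)
       (use h in \<open>auto simp: has_bochner_integral_iff\<close>)
qed

lemma space_obs: "space (obs_space \<nu>) = UNIV \<times> UNIV \<times> space \<nu>"
  by (simp add: obs_space_def space_pair_measure)

lemma sets_law: "sets (law \<nu> a b f) = sets (obs_space \<nu>)"
  by (simp add: law_def)

lemma bern_pos: "0 < q \<Longrightarrow> q < 1 \<Longrightarrow> 0 < bern q y"
  by (simp add: bern_def)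

lemma measurable_censor:
  "(\<lambda>(y, \<alpha>, z). (y \<and> \<alpha>, \<alpha>, z)) \<in> measurable (obs_space \<nu>) (obs_space \<nu>)"
  by (rule measurable_obs) (auto simp: obs_space_def intro!: measurable_Pair)

lemma measurable_full_density:
  assumes "model \<nu> a b f"
  shows "(\<lambda>(y, \<alpha>, z). bern (b z) y * bern (1 / a z) \<alpha> * f z) \<in> borel_measurable (obs_space \<nu>)"
proof (rule measurable_obs)
  fix y \<alpha>
  from assms have [measurable]: "a \<in> borel_measurable \<nu>" "b \<in> borel_measurable \<nu>" "f \<in> borel_measurable \<nu>"
    by (auto simp: model_def)
  show "(\<lambda>z. case (y, \<alpha>, z) of (y, \<alpha>, z) \<Rightarrow> bern (b z) y * bern (1 / a z) \<alpha> * f z) \<in> borel_measurable \<nu>"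
    by (cases y; cases \<alpha>) (simp_all add: bern_def)
qed

lemma full_density_pos:
  assumes "model \<nu> a b f" "x \<in> space (obs_space \<nu>)"
  shows "0 < (case x of (y, \<alpha>, z) \<Rightarrow> bern (b z) y * bern (1 / a z) \<alpha> * f z)"
  using assms(2) modelD[OF assms(1)] by (auto simp: space_obs intro!: mult_pos_pos bern_pos)

text \<open>Given \<open>Z\<close>, the means of \<open>YA\<close> and \<open>A\<close> are
  \<open>b / a\<close> and \<open>1 / a\<close>, and \<open>f\<close> is \<open>a\<close> times
  \<open>f / a\<close>, so all three terms share the density \<open>f / a\<close>. The score,
  \<open>A_tilde * e p\<close>, \<open>Y_tilde * e p\<close> and the Gram integrands all have this
  shape.\<close>

lemma law_integral:
  assumes model: "model \<nu> a b f"
    and u: "integrable \<nu> u" and v: "integrable \<nu> v" and w: "integrable \<nu> w"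
  shows "has_bochner_integral (law \<nu> a b f)
      (\<lambda>x. obs_YA x * u (obs_Z x) + obs_A x * v (obs_Z x) + w (obs_Z x))
      (\<integral>z. (b z * u z + v z + a z * w z) * (f z / a z) \<partial>\<nu>)"
proof -
  note m = modelD[OF model]
  interpret finite_measure \<nu> by (rule m)
  let ?h = "\<lambda>x. obs_YA x * u (obs_Z x) + obs_A x * v (obs_Z x) + w (obs_Z x)"
  let ?T = "\<lambda>(y, \<alpha>, z). (y \<and> \<alpha>, \<alpha>, z)"
  let ?q = "\<lambda>(y, \<alpha>, z). bern (b z) y * bern (1 / a z) \<alpha> * f z"
  have h: "?h \<in> borel_measurable (obs_space \<nu>)"
    by (rule measurable_obs) (use u v w in auto)
  let ?H = "\<lambda>y \<alpha> z. ?q (y, \<alpha>, z) * ?h (?T (y, \<alpha>, z))"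
  have bb: "bounded_meas \<nu> (\<lambda>z. bern (b z) y * bern (1 / a z) \<alpha> * f z)" for y \<alpha>
    unfolding bern_def
    by (cases y; cases \<alpha>; simp only: if_True if_False; intro bounded_meas_mult bounded_meas_diff bounded_meas_const m)
  have H: "integrable \<nu> (?H y \<alpha>)" for y \<alpha>
    using bounded_meas_integrable_mult[OF bb[of y \<alpha>]] u v w
    by simp
  have "has_bochner_integral (obs_space \<nu>) (\<lambda>x. ?q x *\<^sub>R ?h (?T x)) (\<Sum>y\<in>UNIV. \<Sum>\<alpha>\<in>UNIV. \<integral>z. ?H y \<alpha> z \<partial>\<nu>)"
    using has_bochner_integral_obs[OF finite_measure_axioms, of "\<lambda>x. ?q x *\<^sub>R ?h (?T x)"] H by simp
  also have "(\<Sum>y\<in>UNIV. \<Sum>\<alpha>\<in>UNIV. \<integral>z. ?H y \<alpha> z \<partial>\<nu>) = (\<integral>z. (\<Sum>y\<in>UNIV. \<Sum>\<alpha>\<in>UNIV. ?H y \<alpha> z) \<partial>\<nu>)"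
    using H by (simp add: Bochner_Integration.integral_sum)
  also have "\<dots> = (\<integral>z. (b z * u z + v z + a z * w z) * (f z / a z) \<partial>\<nu>)"
  proof (intro Bochner_Integration.integral_cong refl)
    fix z assume "z \<in> space \<nu>"
    then have "a z \<noteq> 0" using m(7) by force
    then show "(\<Sum>y\<in>UNIV. \<Sum>\<alpha>\<in>UNIV. ?H y \<alpha> z) = (b z * u z + v z + a z * w z) * (f z / a z)"
      by (simp add: UNIV_bool bern_def field_simps)
  qed
  finally have "has_bochner_integral (density (obs_space \<nu>) ?q) (\<lambda>x. ?h (?T x))
     (\<integral>z. (b z * u z + v z + a z * w z) * (f z / a z) \<partial>\<nu>)"
    by (intro has_bochner_integral_density measurable_compose[OF measurable_censor h] measurable_full_density[OF model] AE_I2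
        less_imp_le full_density_pos[OF model])
  moreover have "density (obs_space \<nu>) ?q = full_law \<nu> a b f"
    unfolding full_law_def by (intro arg_cong[where f = "density (obs_space \<nu>)"]) auto
  ultimately have "has_bochner_integral (full_law \<nu> a b f) (\<lambda>x. ?h (?T x))
     (\<integral>z. (b z * u z + v z + a z * w z) * (f z / a z) \<partial>\<nu>)"
    by simp
  then show ?thesis
    unfolding law_def
    by (intro has_bochner_integral_distr h) (simp_all add: full_law_def measurable_censor)
qed

lemma prob_space_law:
  assumes "model \<nu> a b f"
  shows "prob_space (law \<nu> a b f)"
proof -
  note m = modelD[OF assms]
  interpret finite_measure \<nu> by (rule m)
  have "(\<integral>z. (b z * 0 + 0 + a z * 1) * (f z / a z) \<partial>\<nu>) = (\<integral>z. f z \<partial>\<nu>)"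
    by (intro Bochner_Integration.integral_cong refl) (use m(7) in force)
  with law_integral[OF assms, of "\<lambda>z. 0" "\<lambda>z. 0" "\<lambda>z. 1"] m(12)
  have one: "has_bochner_integral (law \<nu> a b f) (\<lambda>x. 1 :: real) 1" by simp
  then have "emeasure (law \<nu> a b f) (space (law \<nu> a b f)) < \<infinity>"
    by (auto simp: has_bochner_integral_iff integrable_iff_bounded)
  then interpret L: finite_measure "law \<nu> a b f" by (intro finite_measureI) auto
  show ?thesis
    by standard (use one in \<open>simp add: has_bochner_integral_iff L.emeasure_eq_measure\<close>)
qed

text \<open>The density of \<open>(Y, A, Z)\<close> is strictly positive in the model. A set is
  therefore null for the observed law exactly when its preimage under censoring is null for the base
  measure, a condition free of the parameters.\<close>

lemma absolutely_continuous_law: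
  assumes "model \<nu> a b f" "model \<nu> a' b' f'"
  shows "absolutely_continuous (law \<nu> a b f) (law \<nu> a' b' f')"
  unfolding absolutely_continuous_def
proof
  fix N assume N: "N \<in> null_sets (law \<nu> a b f)"
  have T: "(\<lambda>(y, \<alpha>, z). (y \<and> \<alpha>, \<alpha>, z)) \<in> measurable (full_law \<nu> a b f) (obs_space \<nu>)" for a b f
    by (simp add: full_law_def measurable_censor)
  have null: "N \<in> null_sets (law \<nu> a b f) \<longleftrightarrow> N \<in> sets (obs_space \<nu>) \<and>
      (AE x in obs_space \<nu>. x \<notin> (\<lambda>(y, \<alpha>, z). (y \<and> \<alpha>, \<alpha>, z)) -` N \<inter> space (obs_space \<nu>))"
    if "model \<nu> a b f" for a b f
  proof -
    let ?q = "\<lambda>(y, \<alpha>, z). ennreal (bern (b z) y * bern (1 / a z) \<alpha> * f z)"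
    have q_eq: "?q = (\<lambda>x. ennreal (case x of (y, \<alpha>, z) \<Rightarrow> bern (b z) y * bern (1 / a z) \<alpha> * f z))"
      by auto
    have q: "?q \<in> borel_measurable (obs_space \<nu>)"
      unfolding q_eq using measurable_full_density[OF that] by simp
    have q0: "?q x \<noteq> 0" if "x \<in> space (obs_space \<nu>)" for x
      using full_density_pos[OF \<open>model \<nu> a b f\<close> that] by (auto simp: ennreal_eq_0_iff split: prod.splits)
    let ?S = "(\<lambda>(y, \<alpha>, z). (y \<and> \<alpha>, \<alpha>, z)) -` N \<inter> space (obs_space \<nu>)"
    have "N \<in> null_sets (law \<nu> a b f) \<longleftrightarrow> ?S \<in> null_sets (full_law \<nu> a b f) \<and> N \<in> sets (obs_space \<nu>)"
      unfolding law_def using null_sets_distr_iff[OF T] by (simp add: full_law_def)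
    also have "?S \<in> null_sets (full_law \<nu> a b f) \<longleftrightarrow> ?S \<in> sets (obs_space \<nu>) \<and> (AE x in obs_space \<nu>. x \<in> ?S \<longrightarrow> ?q x = 0)"
      unfolding full_law_def by (rule null_sets_density_iff[OF q])
    also have "(AE x in obs_space \<nu>. x \<in> ?S \<longrightarrow> ?q x = 0) \<longleftrightarrow> (AE x in obs_space \<nu>. x \<notin> ?S)"
      by (rule AE_cong) (use q0 in auto)
    finally show ?thesis
      using measurable_sets[OF measurable_censor[of \<nu>], of N] by auto
  qed
  from N show "N \<in> null_sets (law \<nu> a' b' f')"
    unfolding null[OF assms(1)] null[OF assms(2)] .
qed

section \<open>Projections onto a finite-dimensional subspace\<close>

lemma mat_mult_index_sum:
  assumes "A \<in> carrier_mat n n" "B \<in> carrier_mat n n" "i < n" "j < n"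
  shows "(A * B) $$ (i, j) = (\<Sum>q<n. A $$ (i, q) * B $$ (q, j))"
  using assms by (auto simp: scalar_prod_def lessThan_atLeast0 intro!: sum.cong)

lemma mat_inverse_left_inverse:
  fixes A :: "real mat"
  assumes A: "A \<in> carrier_mat n n" and "Determinant.det A \<noteq> 0" and "p < n" "r < n"
  shows "(\<Sum>q<n. the (mat_inverse A) $$ (p, q) * A $$ (q, r)) = of_bool (p = r)"
proof -
  have "A \<in> Units (ring_mat TYPE(real) n ())"
    by (rule det_non_zero_imp_unit) fact+
  with mat_inverse(1)[OF A] obtain B where "mat_inverse A = Some B" by fastforce
  with mat_inverse(2)[OF A this] mat_mult_index_sum[of B n A p r] assms show ?thesis
    by (cases "p = r") auto
qed

text \<open>Cramer's rule, with adjugate and determinant kept separate because their dependence on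
  \<open>t\<close> is visibly analytic. One direction solves the normal equations, the other
  identifies coordinates already known to satisfy them.\<close>

lemma solve_adj_mat:
  fixes A :: "real mat"
  assumes A: "A \<in> carrier_mat n n" and det: "Determinant.det A \<noteq> 0"
  shows "(\<forall>p<n. (\<Sum>q<n. A $$ (p, q) * c q) = r p) \<longleftrightarrow>
    (\<forall>p<n. c p = (\<Sum>q<n. adj_mat A $$ (p, q) * r q) * inverse (Determinant.det A))"
proof (intro iffI allI impI)
  note adj = adj_mat[OF A]
  have left: "(\<Sum>q<n. adj_mat A $$ (p, q) * A $$ (q, s)) = Determinant.det A * of_bool (p = s)" if "p < n" "s < n" for p s
    using mat_mult_index_sum[OF adj(1) A that] adj(3) that by (cases "p = s") auto
  have right: "(\<Sum>q<n. A $$ (p, q) * adj_mat A $$ (q, s)) = Determinant.det A * of_bool (p = s)" if "p < n" "s < n" for p s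
    using mat_mult_index_sum[OF A adj(1) that] adj(2) that by (cases "p = s") auto
  { fix p assume eq: "\<forall>p<n. (\<Sum>q<n. A $$ (p, q) * c q) = r p" and p: "p < n"
    have "(\<Sum>q<n. adj_mat A $$ (p, q) * r q) = (\<Sum>q<n. adj_mat A $$ (p, q) * (\<Sum>s<n. A $$ (q, s) * c s))"
      using eq by simp
    also have "\<dots> = (\<Sum>s<n. (\<Sum>q<n. adj_mat A $$ (p, q) * A $$ (q, s)) * c s)"
      unfolding sum_distrib_left sum_distrib_right by (subst sum.swap) (simp add: mult_ac)
    also have "\<dots> = (\<Sum>s<n. Determinant.det A * of_bool (p = s) * c s)"
      using left[OF p] by simp
    also have "\<dots> = Determinant.det A * c p"
      using p by (subst sum.remove[of _ p]) auto
    finally show "c p = (\<Sum>q<n. adj_mat A $$ (p, q) * r q) * inverse (Determinant.det A)"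
      using det by (simp add: field_simps) }
  { fix p assume eq: "\<forall>p<n. c p = (\<Sum>q<n. adj_mat A $$ (p, q) * r q) * inverse (Determinant.det A)" and p: "p < n"
    have "(\<Sum>q<n. A $$ (p, q) * c q) = (\<Sum>q<n. A $$ (p, q) * ((\<Sum>s<n. adj_mat A $$ (q, s) * r s) * inverse (Determinant.det A)))"
      using eq by simp
    also have "\<dots> = (\<Sum>s<n. (\<Sum>q<n. A $$ (p, q) * adj_mat A $$ (q, s)) * (r s * inverse (Determinant.det A)))"
      unfolding sum_distrib_left sum_distrib_right by (subst sum.swap) (simp add: mult_ac)
    also have "\<dots> = (\<Sum>s<n. Determinant.det A * of_bool (p = s) * (r s * inverse (Determinant.det A)))"
      using right[OF p] by simp
    also have "\<dots> = r p"
      using p det by (subst sum.remove[of _ p]) auto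
    finally show "(\<Sum>q<n. A $$ (p, q) * c q) = r p" . }
qed

section \<open>Gram matrices and the normal equations\<close>

locale L2_space = finite_measure \<nu>
  for \<nu> :: "'z measure" +
  fixes L :: "('z \<Rightarrow> real) set" and k :: nat and e :: "nat \<Rightarrow> 'z \<Rightarrow> real"
  assumes subspace: "L2_subspace \<nu> L" and basis: "L2_basis \<nu> L k e"
begin

lemma sq_int_L: "u \<in> L \<Longrightarrow> sq_int \<nu> u"
  using subspace by (auto simp: L2_subspace_def sq_int_def)

lemma L_add: "u \<in> L \<Longrightarrow> v \<in> L \<Longrightarrow> (\<lambda>z. u z + v z) \<in> L"
  using subspace by (simp add: L2_subspace_def)

lemma L_scale: "u \<in> L \<Longrightarrow> (\<lambda>z. c * u z) \<in> L"
  using subspace by (simp add: L2_subspace_def)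

lemma L_diff: "u \<in> L \<Longrightarrow> v \<in> L \<Longrightarrow> (\<lambda>z. u z - v z) \<in> L"
  using L_add[OF _ L_scale[of v "-1"], of u] by simp

lemma basis_in_L: "i < k \<Longrightarrow> e i \<in> L"
  using basis by (auto simp: L2_basis_def)

lemma basis_comb_in_L: "(\<lambda>z. \<Sum>i<n. c i * e i z) \<in> L" if "n \<le> k"
  using that
proof (induction n)
  case 0
  then show ?case using subspace by (simp add: L2_subspace_def)
next
  case (Suc n)
  then have "(\<lambda>z. c n * e n z) \<in> L"
    by (intro L_scale basis_in_L) simp
  with Suc show ?case using L_add by simp
qed

lemma gram_carrier: "gram \<nu> w k e \<in> carrier_mat k k"
  by (simp add: gram_def)

lemma gram_index: "i < k \<Longrightarrow> j < k \<Longrightarrow> gram \<nu> w k e $$ (i, j) = (\<integral>z. e i z * e j z * w z \<partial>\<nu>)"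
  by (simp add: gram_def)

lemma sq_int_weighted_integrable:
  "sq_int \<nu> u \<Longrightarrow> sq_int \<nu> v \<Longrightarrow> bounded_meas \<nu> w \<Longrightarrow> integrable \<nu> (\<lambda>z. u z * v z * w z)"
  using bounded_meas_integrable_mult[OF _ sq_int_mult_integrable, of \<nu> w u v] by (simp add: mult_ac)

lemma integral_basis_expansion:
  assumes "sq_int \<nu> u" "bounded_meas \<nu> w" "AE z in \<nu>. v z = (\<Sum>i<k. c i * e i z)"
    and "v \<in> borel_measurable \<nu>"
  shows "(\<integral>z. u z * v z * w z \<partial>\<nu>) = (\<Sum>i<k. c i * (\<integral>z. u z * e i z * w z \<partial>\<nu>))"
proof -
  have [measurable]: "e i \<in> borel_measurable \<nu>" if "i < k" for i
    using sq_int_L[OF basis_in_L[OF that]] by (simp add: sq_int_def)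
  have [measurable]: "u \<in> borel_measurable \<nu>" "v \<in> borel_measurable \<nu>" "w \<in> borel_measurable \<nu>"
    using assms by (auto simp: sq_int_def bounded_meas_def)
  have "(\<integral>z. u z * v z * w z \<partial>\<nu>) = (\<integral>z. (\<Sum>i<k. c i * (u z * e i z * w z)) \<partial>\<nu>)"
    by (rule integral_cong_AE)
       (use assms(3) in \<open>auto simp: sum_distrib_left sum_distrib_right mult_ac elim!: eventually_mono\<close>)
  also have "\<dots> = (\<Sum>i<k. c i * (\<integral>z. u z * e i z * w z \<partial>\<nu>))"
    by (subst Bochner_Integration.integral_sum)
       (auto intro!: sq_int_weighted_integrable assms sq_int_L basis_in_L)
  finally show ?thesis .
qed

text \<open>A vector in the kernel gives a combination of the basis with zero weighted norm. As the
  weight is positive, the combination vanishes almost everywhere, against linear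
  independence.\<close>

lemma gram_det_nonzero:
  assumes w: "bounded_meas \<nu> w" and pos: "\<And>z. z \<in> space \<nu> \<Longrightarrow> 0 < w z"
  shows "Determinant.det (gram \<nu> w k e) \<noteq> 0"
proof
  assume "Determinant.det (gram \<nu> w k e) = 0"
  then obtain v where v: "v \<in> carrier_vec k" "v \<noteq> 0\<^sub>v k" "gram \<nu> w k e *\<^sub>v v = 0\<^sub>v k"
    using det_0_iff_vec_prod_zero_field[OF gram_carrier] by blast
  let ?u = "\<lambda>z. \<Sum>i<k. vec_index v i * e i z"
  have uL: "?u \<in> L" by (rule basis_comb_in_L) simp
  note u = sq_int_L[OF uL]
  have row: "(\<Sum>j<k. vec_index v j * (\<integral>z. e i z * e j z * w z \<partial>\<nu>)) = 0" if "i < k" for i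
  proof -
    have "vec_index (gram \<nu> w k e *\<^sub>v v) i = 0" using v that by simp
    then show ?thesis
      using v(1) that gram_carrier[of w]
      by (simp add: scalar_prod_def gram_index lessThan_atLeast0 mult.commute gram_def)
  qed
  have "(\<integral>z. ?u z * ?u z * w z \<partial>\<nu>) = (\<Sum>i<k. vec_index v i * (\<integral>z. ?u z * e i z * w z \<partial>\<nu>))"
    by (rule integral_basis_expansion) (use u w in \<open>auto simp: sq_int_def\<close>)
  also have "\<dots> = 0"
  proof (intro sum.neutral ballI)
    fix i assume "i \<in> {..<k}"
    then have i: "i < k" by simp
    have "(\<integral>z. ?u z * e i z * w z \<partial>\<nu>) = (\<integral>z. e i z * ?u z * w z \<partial>\<nu>)"
      by (simp only: mult.commute mult.left_commute)
    also have "\<dots> = 0"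
      by (subst integral_basis_expansion[OF sq_int_L[OF basis_in_L[OF i]] w])
         (use u row[OF i] in \<open>auto simp: sq_int_def\<close>)
    finally show "vec_index v i * (\<integral>z. ?u z * e i z * w z \<partial>\<nu>) = 0" by simp
  qed
  finally have "(\<integral>z. ?u z * ?u z * w z \<partial>\<nu>) = 0" .
  then have "AE z in \<nu>. ?u z * ?u z * w z = 0"
    by (subst (asm) integral_nonneg_eq_0_iff_AE)
       (auto intro!: sq_int_weighted_integrable u w AE_I2 mult_nonneg_nonneg[OF zero_le_square] less_imp_le[OF pos])
  then have "AE z in \<nu>. ?u z = 0"
    by (rule AE_mp) (use pos in \<open>auto intro!: AE_I2 simp: less_le\<close>)
  then have "\<forall>i<k. vec_index v i = 0"
    using basis unfolding L2_basis_def by blast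
  then have "v = 0\<^sub>v k" using v(1) by (intro eq_vecI) auto
  with v show False by simp
qed

text \<open>\<open>orth_proj\<close> is a choice and has its defining property only once some
  function has it. Solving the normal equations produces such a function, and testing against basis
  functions suffices.\<close>

lemma orth_proj_exists:
  assumes w: "bounded_meas \<nu> w" and pos: "\<And>z. z \<in> space \<nu> \<Longrightarrow> 0 < w z" and h: "sq_int \<nu> h"
  shows "orth_proj \<nu> w L h \<in> L \<and> (\<forall>v\<in>L. (\<integral>z. (h z - orth_proj \<nu> w L h z) * v z * w z \<partial>\<nu>) = 0)"
proof -
  let ?A = "gram \<nu> w k e"
  define r where "r p = (\<integral>z. h z * e p z * w z \<partial>\<nu>)" for p
  define c where "c p = (\<Sum>q<k. adj_mat ?A $$ (p, q) * r q) * inverse (Determinant.det ?A)" for p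
  have Ac: "\<forall>p<k. (\<Sum>q<k. ?A $$ (p, q) * c q) = r p"
    by (rule iffD2[OF solve_adj_mat[OF gram_carrier gram_det_nonzero[OF w pos]]]) (auto simp: c_def)
  have c: "(\<Sum>q<k. c q * (\<integral>z. e p z * e q z * w z \<partial>\<nu>)) = (\<integral>z. h z * e p z * w z \<partial>\<nu>)" if "p < k" for p
  proof -
    have "(\<Sum>q<k. c q * (\<integral>z. e p z * e q z * w z \<partial>\<nu>)) = (\<Sum>q<k. ?A $$ (p, q) * c q)"
      using that by (intro sum.cong refl) (simp add: gram_index)
    with Ac that show ?thesis by (simp add: r_def)
  qed
  define u where "u = (\<lambda>z. \<Sum>i<k. c i * e i z)"
  have uL: "u \<in> L" unfolding u_def by (rule basis_comb_in_L) simp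
  note u = sq_int_L[OF uL]
  note eL = sq_int_L[OF basis_in_L]
  have "(\<integral>z. (h z - u z) * v z * w z \<partial>\<nu>) = 0" if v: "v \<in> L" for v
  proof -
    obtain d where d: "AE z in \<nu>. v z = (\<Sum>i<k. d i * e i z)"
      using basis v unfolding L2_basis_def by blast
    have "(\<integral>z. (h z - u z) * e p z * w z \<partial>\<nu>) = 0" if p: "p < k" for p
    proof -
      have "(\<integral>z. (h z - u z) * e p z * w z \<partial>\<nu>) = (\<integral>z. h z * e p z * w z - e p z * u z * w z \<partial>\<nu>)"
        by (intro Bochner_Integration.integral_cong refl) (simp add: algebra_simps)
      also have "\<dots> = (\<integral>z. h z * e p z * w z \<partial>\<nu>) - (\<integral>z. e p z * u z * w z \<partial>\<nu>)"
        by (intro Bochner_Integration.integral_diff sq_int_weighted_integrable h eL p u w)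
      also have "(\<integral>z. e p z * u z * w z \<partial>\<nu>) = (\<Sum>q<k. c q * (\<integral>z. e p z * e q z * w z \<partial>\<nu>))"
        by (rule integral_basis_expansion[OF eL[OF p] w]) (use u in \<open>auto simp: sq_int_def u_def\<close>)
      finally show ?thesis using c[OF p] by simp
    qed
    then show ?thesis
      by (subst integral_basis_expansion[OF sq_int_diff[OF h u] w d])
         (use sq_int_L[OF v] in \<open>auto simp: sq_int_def\<close>)
  qed
  with uL have "\<exists>u. u \<in> L \<and> (\<forall>v\<in>L. (\<integral>z. (h z - u z) * v z * w z \<partial>\<nu>) = 0)" by blast
  from someI_ex[OF this] show ?thesis unfolding orth_proj_def .
qed

text \<open>The common form of the two approximations: \<open>und\<close> is the weight defining the approximation of
  \<open>h\<close>, \<open>oth\<close> the weight of the other parameter.\<close>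

lemma tilde_orthogonal:
  assumes und: "bounded_meas \<nu> und" "bounded_away \<nu> {0<..} und"
    and oth: "bounded_meas \<nu> oth" "bounded_away \<nu> {0<..} oth"
    and hat: "bounded_meas \<nu> hat" and h: "bounded_meas \<nu> h"
    and g: "bounded_meas \<nu> g" "\<And>z. z \<in> space \<nu> \<Longrightarrow> 0 < g z"
    and w: "\<And>z. w z = und z * oth z * g z"
  obtains u where "u \<in> L" "\<And>z. tilde \<nu> w L hat und h z = hat z + und z * u z"
    "\<And>v. v \<in> L \<Longrightarrow> (\<integral>z. (h z - tilde \<nu> w L hat und h z) * v z * (oth z * g z) \<partial>\<nu>) = 0"
proof
  let ?h = "\<lambda>z. (h z - hat z) / und z"
  have pos: "0 < und z" "0 < oth z" if "z \<in> space \<nu>" for z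
    using und oth that by (force simp: bounded_away_def)+
  have bw: "bounded_meas \<nu> w"
    unfolding w[abs_def] by (intro bounded_meas_mult und oth g)
  have wpos: "0 < w z" if "z \<in> space \<nu>" for z
    using pos[OF that] g(2)[OF that] by (simp add: w)
  have "bounded_meas \<nu> (\<lambda>z. (h z - hat z) * (1 / und z))"
    by (intro bounded_meas_mult bounded_meas_diff h hat bounded_meas_inverse und)
       (use und in \<open>auto simp: bounded_meas_def\<close>)
  then have "sq_int \<nu> ?h" by (simp add: bounded_meas_sq_int)
  from orth_proj_exists[OF bw wpos this]
  show "orth_proj \<nu> w L ?h \<in> L" by blast
  from orth_proj_exists[OF bw wpos \<open>sq_int \<nu> ?h\<close>]
  have orth: "(\<integral>z. (?h z - orth_proj \<nu> w L ?h z) * v z * w z \<partial>\<nu>) = 0" if "v \<in> L" for v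
    using that by blast
  show tilde: "tilde \<nu> w L hat und h z = hat z + und z * orth_proj \<nu> w L ?h z" for z
    by (simp add: tilde_def)
  fix v assume "v \<in> L"
  \<comment> \<open>One factor \<open>und\<close> of the weight cancels the division by
    \<open>und\<close> in the projected function, which leaves the weight
    \<open>oth * g\<close>.\<close>
  have "(\<integral>z. (h z - tilde \<nu> w L hat und h z) * v z * (oth z * g z) \<partial>\<nu>)
      = (\<integral>z. (?h z - orth_proj \<nu> w L ?h z) * v z * w z \<partial>\<nu>)"
  proof (intro Bochner_Integration.integral_cong refl)
    fix z assume "z \<in> space \<nu>"
    from pos(1)[OF this] show "(h z - tilde \<nu> w L hat und h z) * v z * (oth z * g z)
      = (?h z - orth_proj \<nu> w L ?h z) * v z * w z"
      by (simp add: tilde w field_simps)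
  qed
  then show "(\<integral>z. (h z - tilde \<nu> w L hat und h z) * v z * (oth z * g z) \<partial>\<nu>) = 0"
    using orth[OF \<open>v \<in> L\<close>] by simp
qed

end

section \<open>Kernel chains and the Neumann series\<close>

text \<open>Entry \<open>q\<close> of the row vector \<open>\<alpha> K M\<^sub>0 K M\<^sub>1 \<dots> K\<close>. The middle matrices depend on the position so that
  the same recursion describes the chain of kernels at given observations and its integral.\<close>

primrec row_chain :: "nat \<Rightarrow> (nat \<Rightarrow> nat \<Rightarrow> real) \<Rightarrow> (nat \<Rightarrow> real) \<Rightarrow> (nat \<Rightarrow> nat \<Rightarrow> nat \<Rightarrow> real) \<Rightarrow> nat \<Rightarrow> nat \<Rightarrow> real" where
  "row_chain k K \<alpha> M 0 q = (\<Sum>p<k. \<alpha> p * K p q)"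
| "row_chain k K \<alpha> M (Suc n) q = (\<Sum>p<k. (\<Sum>r<k. row_chain k K \<alpha> M n r * M n r p) * K p q)"

text \<open>Cancels \<open>K\<close> against \<open>C\<close> at the end of a chain, in the index
  form in which \<open>row_chain\<close> is written.\<close>

lemma left_inverse_sum:
  fixes K C :: "nat \<Rightarrow> nat \<Rightarrow> real"
  assumes "\<And>p r. p < k \<Longrightarrow> r < k \<Longrightarrow> (\<Sum>q<k. K p q * C q r) = of_bool (p = r)"
  shows "(\<Sum>q<k. (\<Sum>p<k. \<alpha> p * K p q) * (\<Sum>r<k. C q r * \<gamma> r)) = (\<Sum>p<k. \<alpha> p * \<gamma> p)"
proof -
  have "(\<Sum>q<k. (\<Sum>p<k. \<alpha> p * K p q) * (\<Sum>r<k. C q r * \<gamma> r))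
      = (\<Sum>q<k. \<Sum>p<k. \<Sum>r<k. \<alpha> p * (K p q * C q r) * \<gamma> r)"
    by (simp add: sum_product mult_ac)
  also have "\<dots> = (\<Sum>p<k. \<Sum>r<k. \<Sum>q<k. \<alpha> p * (K p q * C q r) * \<gamma> r)"
    by (subst sum.swap) (intro sum.cong refl sum.swap)
  also have "\<dots> = (\<Sum>p<k. \<Sum>r<k. \<alpha> p * (\<Sum>q<k. K p q * C q r) * \<gamma> r)"
    by (simp add: sum_distrib_left sum_distrib_right)
  also have "\<dots> = (\<Sum>p<k. \<Sum>r<k. if p = r then \<alpha> p * \<gamma> r else 0)"
    by (intro sum.cong refl) (simp add: assms)
  also have "\<dots> = (\<Sum>p<k. \<alpha> p * \<gamma> p)"
    by (intro sum.cong refl) simp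
  finally show ?thesis .
qed

text \<open>The Neumann series of \<open>(C + M)\<^bsup>-1\<^esup>\<close> around \<open>K = C\<^bsup>-1\<^esup>\<close>, with its exact remainder.\<close>

lemma row_chain_neumann:
  assumes KC: "\<And>p r. p < k \<Longrightarrow> r < k \<Longrightarrow> (\<Sum>q<k. K p q * C q r) = of_bool (p = r)"
    and solve: "\<And>p. p < k \<Longrightarrow> (\<Sum>q<k. (C p q + M p q) * \<gamma> q) = \<beta> p"
  shows "(\<Sum>n<N. (-1) ^ n * (\<Sum>q<k. row_chain k K \<alpha> (\<lambda>_. M) n q * \<beta> q)) =
    (\<Sum>p<k. \<alpha> p * \<gamma> p) - (-1) ^ N * (\<Sum>q<k. row_chain k K \<alpha> (\<lambda>_. M) N q * (\<Sum>r<k. C q r * \<gamma> r))"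
proof (induction N)
  case 0
  have "(\<Sum>q<k. (\<Sum>p<k. \<alpha> p * K p q) * (\<Sum>r<k. C q r * \<gamma> r)) = (\<Sum>p<k. \<alpha> p * \<gamma> p)"
    by (rule left_inverse_sum[OF KC])
  then show ?case by simp
next
  case (Suc N)
  let ?R = "row_chain k K \<alpha> (\<lambda>_. M)"
  have "(\<Sum>q<k. ?R (Suc N) q * (\<Sum>r<k. C q r * \<gamma> r)) = (\<Sum>p<k. (\<Sum>r<k. ?R N r * M r p) * \<gamma> p)"
    by (simp add: left_inverse_sum[OF KC])
  also have "\<dots> = (\<Sum>r<k. ?R N r * (\<Sum>p<k. M r p * \<gamma> p))"
    unfolding sum_distrib_left sum_distrib_right by (subst sum.swap) (simp add: mult_ac)
  finally have 1: "(\<Sum>q<k. ?R (Suc N) q * (\<Sum>r<k. C q r * \<gamma> r)) = (\<Sum>r<k. ?R N r * (\<Sum>p<k. M r p * \<gamma> p))" .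
  \<comment> \<open>Splitting \<open>\<beta>\<close> as \<open>C \<gamma> + M \<gamma>\<close> makes
    the sum telescope: the first part cancels the remainder at \<open>N\<close>, and the second is
    the remainder at \<open>Suc N\<close>.\<close>
  have "(\<Sum>q<k. ?R N q * \<beta> q) = (\<Sum>q<k. ?R N q * (\<Sum>r<k. C q r * \<gamma> r)) + (\<Sum>r<k. ?R N r * (\<Sum>p<k. M r p * \<gamma> p))"
    unfolding sum.distrib[symmetric]
  proof (intro sum.cong refl)
    fix q assume "q \<in> {..<k}"
    then have "(\<Sum>r<k. C q r * \<gamma> r) + (\<Sum>p<k. M q p * \<gamma> p) = \<beta> q"
      using solve[of q] by (simp add: ring_distribs sum.distrib)
    then show "?R N q * \<beta> q = ?R N q * (\<Sum>r<k. C q r * \<gamma> r) + ?R N q * (\<Sum>p<k. M q p * \<gamma> p)"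
      by (simp flip: ring_distribs(1))
  qed
  with 1 Suc show ?case by (simp add: algebra_simps)
qed

text \<open>One order comes from \<open>\<alpha>\<close> and one from each of the \<open>n\<close>
  factors \<open>M\<close>; the matrix \<open>K\<close> belongs to the fixed law and does not move
  with \<open>t\<close>.\<close>

lemma row_chain_analytic:
  assumes \<alpha>: "\<And>p. p < k \<Longrightarrow> analytic_order_ge 1 (\<lambda>t. \<alpha> t p)"
    and M: "\<And>r p. r < k \<Longrightarrow> p < k \<Longrightarrow> analytic_order_ge 1 (\<lambda>t. M t r p)"
  shows "q < k \<Longrightarrow> analytic_order_ge (Suc n) (\<lambda>t. row_chain k K (\<alpha> t) (\<lambda>_. M t) n q)"
proof (induction n arbitrary: q)
  case 0
  have "analytic_order_ge (1 + 0) (\<lambda>t. \<alpha> t p * K p q)" if "p < k" for p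
    by (rule analytic_order_ge_mult[OF \<alpha>[OF that] analytic_order_ge_const])
  then show ?case by (auto intro!: analytic_order_ge_sum)
next
  case (Suc n)
  have "analytic_order_ge (Suc n + 1) (\<lambda>t. row_chain k K (\<alpha> t) (\<lambda>_. M t) n r * M t r p)" if "r < k" "p < k" for r p
    by (rule analytic_order_ge_mult[OF Suc.IH M]) (use that in auto)
  then have "analytic_order_ge (Suc (Suc n)) (\<lambda>t. \<Sum>r<k. row_chain k K (\<alpha> t) (\<lambda>_. M t) n r * M t r p)" if "p < k" for p
    using that by (auto intro!: analytic_order_ge_sum)
  then have "analytic_order_ge (Suc (Suc n) + 0) (\<lambda>t. (\<Sum>r<k. row_chain k K (\<alpha> t) (\<lambda>_. M t) n r * M t r p) * K p q)" if "p < k" for p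
    using that by (intro analytic_order_ge_mult analytic_order_ge_const)
  then show ?case by (auto intro!: analytic_order_ge_sum)
qed

text \<open>Every step of the recursion brings in a fresh observation: \<open>\<alpha>\<close> uses
  coordinate 1 and the matrix of index \<open>i\<close> uses coordinate \<open>i + 2\<close>. Thus
  \<open>n\<close> steps occupy exactly \<open>1, ..., n + 1\<close>, and
  \<open>tensor_sum_extend\<close> applies each time.\<close>

lemma row_chain_tensor_sum:
  assumes u: "\<And>p. p < k \<Longrightarrow> integrable P (u p) \<and> integrable Q (u p)"
    and v: "\<And>r p. r < k \<Longrightarrow> p < k \<Longrightarrow> integrable P (v r p) \<and> integrable Q (v r p)"
  shows "q < k \<Longrightarrow> tensor_sum P Q (Suc n)
    (\<lambda>x. row_chain k K (\<lambda>p. u p (x 1)) (\<lambda>i r p. v r p (x (i + 2))) n q)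
    (row_chain k K (\<lambda>p. (\<integral>y. u p y \<partial>Q) - (\<integral>y. u p y \<partial>P)) (\<lambda>_ r p. (\<integral>y. v r p y \<partial>Q) - (\<integral>y. v r p y \<partial>P)) n q)"
proof (induction n arbitrary: q)
  case 0
  have "tensor_sum P Q (Suc 0) (\<lambda>x. u p (x 1)) ((\<integral>y. u p y \<partial>Q) - (\<integral>y. u p y \<partial>P))" if "p < k" for p
    using tensor_sum.prod[of "Suc 0" P "\<lambda>_. u p" Q] u[OF that] by simp
  then show ?case
    by (simp only: row_chain.simps) (intro tensor_sum_sum tensor_sum_scale; simp)
next
  case (Suc n)
  have "tensor_sum P Q (Suc (Suc n))
     (\<lambda>x. row_chain k K (\<lambda>p. u p (x 1)) (\<lambda>i r p. v r p (x (i + 2))) n r * v r p (x (n + 2)))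
     (row_chain k K (\<lambda>p. (\<integral>y. u p y \<partial>Q) - (\<integral>y. u p y \<partial>P)) (\<lambda>_ r p. (\<integral>y. v r p y \<partial>Q) - (\<integral>y. v r p y \<partial>P)) n r
       * ((\<integral>y. v r p y \<partial>Q) - (\<integral>y. v r p y \<partial>P)))" if "r < k" "p < k" for r p
    using tensor_sum_extend[OF Suc.IH[OF that(1)], of "v r p"] v[OF that] by simp
  then show ?case
    by (simp only: row_chain.simps) (intro tensor_sum_sum tensor_sum_scale; simp)
qed

text \<open>At given observations the middle matrices have rank one, so the matrix product breaks up
  into a product of scalar kernels.\<close>

lemma row_chain_kernel:
  fixes z :: "nat \<Rightarrow> 'z" and A :: "nat \<Rightarrow> real"
  assumes Ker: "\<And>y z. Ker y z = (\<Sum>p<k. \<Sum>q<k. K p q * e p y * e q z)"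
  shows "(\<Sum>q<k. row_chain k K (\<lambda>p. \<alpha> * e p (z 1)) (\<lambda>i r p. A (i + 2) * e r (z (i + 2)) * e p (z (i + 2))) n q * e q y)
    = \<alpha> * (\<Prod>i=1..<n+1. Ker (z i) (z (i + 1))) * (\<Prod>i=2..<n+2. A i) * Ker (z (n + 1)) y"
proof (induction n arbitrary: y)
  case 0
  have "(\<Sum>q<k. (\<Sum>p<k. \<alpha> * e p (z 1) * K p q) * e q y) = \<alpha> * Ker (z 1) y"
    unfolding Ker sum_distrib_left sum_distrib_right by (subst sum.swap) (simp add: mult_ac)
  then show ?case by simp
next
  case (Suc n)
  let ?R = "row_chain k K (\<lambda>p. \<alpha> * e p (z 1)) (\<lambda>i r p. A (i + 2) * e r (z (i + 2)) * e p (z (i + 2)))"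
  \<comment> \<open>The row before the matrix of index \<open>n\<close> enters only through its
    pairing with the first factor of that rank-one matrix, a scalar.\<close>
  define S where "S = (\<Sum>r<k. ?R n r * e r (z (n + 2)))"
  have "(\<Sum>r<k. ?R n r * (A (n + 2) * e r (z (n + 2)) * e p (z (n + 2)))) = S * (A (n + 2) * e p (z (n + 2)))" for p
    unfolding S_def sum_distrib_right by (simp add: mult_ac)
  then have "(\<Sum>r<k. ?R n r * (A (n + 2) * e r (z (n + 2)) * e p (z (n + 2)))) * K p q * e q y
      = S * (A (n + 2) * (K p q * e p (z (n + 2)) * e q y))" for p q
    by simp
  then have "(\<Sum>q<k. ?R (Suc n) q * e q y)
      = (\<Sum>q<k. \<Sum>p<k. S * (A (n + 2) * (K p q * e p (z (n + 2)) * e q y)))"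
    unfolding row_chain.simps
    by (intro sum.cong refl) (subst sum_distrib_right, rule sum.cong[OF refl])
  also have "\<dots> = S * A (n + 2) * Ker (z (n + 2)) y"
    unfolding Ker by (subst sum.swap) (simp add: sum_distrib_left mult_ac)
  also have "\<dots> = (\<Sum>r<k. ?R n r * e r (z (n + 2))) * A (n + 2) * Ker (z (n + 2)) y"
    by (simp only: S_def)
  also have "\<dots> = \<alpha> * (\<Prod>i=1..<n+1. Ker (z i) (z (i + 1))) * (\<Prod>i=2..<n+2. A i) * Ker (z (n + 1)) (z (n + 2)) * A (n + 2) * Ker (z (n + 2)) y"
    by (simp only: Suc.IH)
  also have "\<dots> = \<alpha> * (\<Prod>i=1..<Suc n+1. Ker (z i) (z (i + 1))) * (\<Prod>i=2..<Suc n+2. A i) * Ker (z (Suc n + 1)) y"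
    by (simp add: prod.atLeastLessThan_Suc mult_ac)
  finally show ?case .
qed

section \<open>Paths in the model\<close>

text \<open>The compact range \<open>[l, r]\<close> inside the open set \<open>I\<close> can be
  widened at both ends by \<open>\<bar>t\<bar> * D\<close> without leaving \<open>I\<close>.\<close>

lemma bounded_away_perturb:
  assumes "open I" "bounded_away \<nu> I u" "bounded_meas \<nu> d"
  shows "\<forall>\<^sub>F t in nhds 0. bounded_away \<nu> I (\<lambda>z. u z + t * d z)"
proof -
  from assms obtain l r where lr: "l \<in> I" "r \<in> I" "\<forall>z\<in>space \<nu>. l \<le> u z \<and> u z \<le> r"
    by (auto simp: bounded_away_def)
  from assms obtain D where D: "\<forall>z\<in>space \<nu>. \<bar>d z\<bar> \<le> D" by (auto simp: bounded_meas_def)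
  have lim: "((\<lambda>t. l - \<bar>t\<bar> * D) \<longlongrightarrow> l - \<bar>0\<bar> * D) (nhds 0)" "((\<lambda>t. r + \<bar>t\<bar> * D) \<longlongrightarrow> r + \<bar>0\<bar> * D) (nhds 0)"
    by (intro tendsto_intros filterlim_ident)+
  have "\<forall>\<^sub>F t in nhds 0. l - \<bar>t\<bar> * D \<in> I" "\<forall>\<^sub>F t in nhds 0. r + \<bar>t\<bar> * D \<in> I"
    using topological_tendstoD[OF lim(1) \<open>open I\<close>] topological_tendstoD[OF lim(2) \<open>open I\<close>] lr by auto
  then show ?thesis
  proof eventually_elim
    case (elim t)
    have "l - \<bar>t\<bar> * D \<le> u z + t * d z \<and> u z + t * d z \<le> r + \<bar>t\<bar> * D" if "z \<in> space \<nu>" for z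
    proof -
      have "\<bar>t * d z\<bar> \<le> \<bar>t\<bar> * D" using D that by (simp add: abs_mult mult_left_mono)
      with lr that show ?thesis by (force simp: abs_le_iff)
    qed
    with elim show ?case unfolding bounded_away_def by blast
  qed
qed

text \<open>The path is affine in \<open>a\<close> whereas the model constrains
  \<open>1 / a\<close>; rewritten for \<open>a\<close> itself, the constraint survives small
  perturbations by \<open>bounded_away_perturb\<close>.\<close>

lemma bounded_away_recip:
  "bounded_away \<nu> {0<..<1} (\<lambda>z. 1 / a z) \<longleftrightarrow> bounded_away \<nu> {1<..} a"
proof
  assume "bounded_away \<nu> {0<..<1} (\<lambda>z. 1 / a z)"
  then obtain l r where lr: "0 < l" "l < 1" "0 < r" "r < 1" "\<And>z. z \<in> space \<nu> \<Longrightarrow> l \<le> 1 / a z \<and> 1 / a z \<le> r"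
    by (auto simp: bounded_away_def)
  have "1 / r \<le> a z \<and> a z \<le> 1 / l" if "z \<in> space \<nu>" for z
  proof -
    have "0 < 1 / a z" using lr(1) lr(5)[OF that] by linarith
    then have "0 < a z" by simp
    with lr(5)[OF that] lr(1,3) show ?thesis by (simp add: field_simps)
  qed
  with lr show "bounded_away \<nu> {1<..} a"
    unfolding bounded_away_def by (intro bexI[of _ "1 / r"] bexI[of _ "1 / l"]) auto
next
  assume "bounded_away \<nu> {1<..} a"
  then obtain l r where lr: "1 < l" "1 < r" "\<And>z. z \<in> space \<nu> \<Longrightarrow> l \<le> a z \<and> a z \<le> r"
    by (auto simp: bounded_away_def)
  have "1 / r \<le> 1 / a z \<and> 1 / a z \<le> 1 / l" if "z \<in> space \<nu>" for z
    using lr(3)[OF that] lr(1,2) by (simp add: frac_le)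
  with lr show "bounded_away \<nu> {0<..<1} (\<lambda>z. 1 / a z)"
    unfolding bounded_away_def by (intro bexI[of _ "1 / r"] bexI[of _ "1 / l"]) auto
qed

lemma bounded_away_mult:
  fixes u v :: "'z \<Rightarrow> real"
  assumes "bounded_away \<nu> {0<..} u" "bounded_away \<nu> {0<..} v"
  shows "bounded_away \<nu> {0<..} (\<lambda>z. u z * v z)"
proof -
  from assms obtain l r l' r' where lr: "0 < l" "0 < r" "0 < l'" "0 < r'"
     "\<And>z. z \<in> space \<nu> \<Longrightarrow> l \<le> u z \<and> u z \<le> r" "\<And>z. z \<in> space \<nu> \<Longrightarrow> l' \<le> v z \<and> v z \<le> r'"
    unfolding bounded_away_def by (metis greaterThan_iff)
  have "l * l' \<le> u z * v z \<and> u z * v z \<le> r * r'" if "z \<in> space \<nu>" for z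
    using lr(5,6)[OF that] lr(1-4) by (auto intro!: mult_mono)
  with lr show ?thesis
    unfolding bounded_away_def by (intro bexI[of _ "l * l'"] bexI[of _ "r * r'"]) auto
qed

lemma bounded_away_mono: "bounded_away \<nu> I u \<Longrightarrow> I \<subseteq> J \<Longrightarrow> bounded_away \<nu> J u"
  unfolding bounded_away_def by blast

lemma model_perturb:
  assumes model: "model \<nu> a b f" and d: "bounded_meas \<nu> da" "bounded_meas \<nu> db" "bounded_meas \<nu> df"
    and int: "(\<integral>z. df z * f z \<partial>\<nu>) = 0"
  shows "\<forall>\<^sub>F t in nhds 0. model \<nu> (\<lambda>z. a z + t * da z) (\<lambda>z. b z + t * db z) (\<lambda>z. f z * (1 + t * df z))"
proof -
  note m = modelD[OF model]
  from model have ba: "bounded_away \<nu> {0<..<1} (\<lambda>z. 1 / a z)" "bounded_away \<nu> {0<..<1} b"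
    "bounded_away \<nu> {0<..} (\<lambda>z. f z / a z)" and fint: "integrable \<nu> f"
    and [measurable]: "a \<in> borel_measurable \<nu>" "b \<in> borel_measurable \<nu>" "f \<in> borel_measurable \<nu>"
    by (auto simp: model_def)
  have [measurable]: "da \<in> borel_measurable \<nu>" "db \<in> borel_measurable \<nu>" "df \<in> borel_measurable \<nu>"
    using d by (auto simp: bounded_meas_def)
  have a1: "bounded_away \<nu> {1<..} a" using ba(1) by (simp add: bounded_away_recip)
  have "bounded_away \<nu> {0<..} (\<lambda>z. f z / a z * a z)"
    by (intro bounded_away_mult ba bounded_away_mono[OF a1]) auto
  then have f0: "bounded_away \<nu> {0<..} f"
    using m(7) unfolding bounded_away_def by (simp add: less_imp_neq[THEN not_sym])
  have one: "bounded_away \<nu> {0<..} (\<lambda>z. 1)" by (auto simp: bounded_away_def intro!: bexI[of _ 1])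
  have "\<forall>\<^sub>F t in nhds 0. bounded_away \<nu> {1<..} (\<lambda>z. a z + t * da z)"
    "\<forall>\<^sub>F t in nhds 0. bounded_away \<nu> {0<..<1} (\<lambda>z. b z + t * db z)"
    "\<forall>\<^sub>F t in nhds 0. bounded_away \<nu> {0<..} (\<lambda>z. 1 + t * df z)"
    by (rule bounded_away_perturb; (intro a1 ba one d open_greaterThan open_greaterThanLessThan))+
  then show ?thesis
  proof eventually_elim
    case (elim t)
    have fdf: "integrable \<nu> (\<lambda>z. df z * f z)"
      by (rule bounded_meas_integrable_mult[OF d(3) fint])
    have "bounded_away \<nu> {0<..} (\<lambda>z. 1 / (a z + t * da z))"
      using elim(1)[folded bounded_away_recip] by (rule bounded_away_mono) auto
    from bounded_away_mult[OF bounded_away_mult[OF f0 elim(3)] this]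
    have "bounded_away \<nu> {0<..} (\<lambda>z. f z * (1 + t * df z) / (a z + t * da z))" by simp
    \<comment> \<open>The total mass stays 1 because \<open>df\<close> has mean zero under
      \<open>f\<close>.\<close>
    moreover have "integrable \<nu> (\<lambda>z. f z * (1 + t * df z))" "(\<integral>z. f z * (1 + t * df z) \<partial>\<nu>) = 1"
      using fint fdf int m(12) by (simp_all add: ring_distribs mult.left_commute mult.commute[of "f _" "df _"])
    ultimately show ?case
      using elim(1)[folded bounded_away_recip] elim(2) by (simp add: model_def)
  qed
qed

text \<open>The reciprocal is a geometric series in \<open>t * da / a\<close>. Its terms are
  dominated by a convergent numerical series times the integrable \<open>\<bar>V\<bar>\<close>, so
  the series may be integrated termwise.\<close>

lemma analytic_integral_reciprocal:
  assumes model: "model \<nu> a b f" and da: "bounded_meas \<nu> da" and U: "integrable \<nu> U"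
  shows "analytic_order_ge 0 (\<lambda>t. \<integral>z. U z * (f z / (a z + t * da z)) \<partial>\<nu>)"
proof -
  note m = modelD[OF model]
  define d where "d z = da z * (1 / a z)" for z
  have d: "bounded_meas \<nu> d" unfolding d_def[abs_def] by (intro bounded_meas_mult da m)
  then obtain D0 where D0: "\<forall>z\<in>space \<nu>. \<bar>d z\<bar> \<le> D0" and [measurable]: "d \<in> borel_measurable \<nu>"
    by (auto simp: bounded_meas_def)
  \<comment> \<open>A uniform bound on the relative increment \<open>da / a\<close>. The added 1
    keeps it positive, so that \<open>1 / D\<close> is a usable radius even for
    \<open>da = 0\<close>.\<close>
  define D where "D = \<bar>D0\<bar> + 1"
  have D: "D > 0" "\<And>z. z \<in> space \<nu> \<Longrightarrow> \<bar>d z\<bar> \<le> D" using D0 by (force simp: D_def)+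
  define V where "V z = f z / a z * U z" for z
  have V: "integrable \<nu> V" unfolding V_def[abs_def] by (intro bounded_meas_integrable_mult m U)
  define F where "F = Abs_fps (\<lambda>n. \<integral>z. V z * (- d z) ^ n \<partial>\<nu>)"
  have "(\<lambda>t. \<integral>z. U z * (f z / (a z + t * da z)) \<partial>\<nu>) has_fps_expansion F"
  proof (rule has_fps_expansionI)
    have "\<forall>\<^sub>F t in nhds (0::real). t \<in> {- 1 / D <..< 1 / D}"
      by (rule eventually_nhds_in_open) (use D in auto)
    then show "\<forall>\<^sub>F t in nhds 0. (\<lambda>n. fps_nth F n * t ^ n) sums (\<integral>z. U z * (f z / (a z + t * da z)) \<partial>\<nu>)"
    proof eventually_elim
      case (elim t)
      then have tD: "\<bar>t\<bar> * D < 1" using D by (auto simp: field_simps abs_if)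
      have bound: "\<bar>t * d z\<bar> \<le> \<bar>t\<bar> * D" if "z \<in> space \<nu>" for z
        using D(2)[OF that] by (simp add: abs_mult mult_left_mono)
      let ?S = "\<lambda>n z. V z * (- t * d z) ^ n"
      have nb: "norm (?S n z) \<le> (\<bar>t\<bar> * D) ^ n * \<bar>V z\<bar>" if "z \<in> space \<nu>" for n z
        using power_mono[OF bound[OF that], of n] by (simp add: abs_mult power_abs mult.commute mult_left_mono)
      have "bounded_meas \<nu> (\<lambda>z. (- t * d z) ^ n)" for n
        by (induction n; simp only: power_0 power_Suc; intro bounded_meas_const bounded_meas_mult d)
      from bounded_meas_integrable_mult[OF this V] have int: "integrable \<nu> (?S n)" for n
        by (simp only: mult.commute)
      have "(\<lambda>n. integral\<^sup>L \<nu> (?S n)) sums (\<integral>z. (\<Sum>n. ?S n z) \<partial>\<nu>)"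
      proof (rule sums_integral[OF int])
        have geo: "summable (\<lambda>n. (\<bar>t\<bar> * D) ^ n * c)" for c
          using tD D by (intro summable_mult2 summable_geometric) (simp add: abs_mult)
        show "AE z in \<nu>. summable (\<lambda>n. norm (?S n z))"
        proof (rule AE_I2)
          fix z assume z: "z \<in> space \<nu>"
          show "summable (\<lambda>n. norm (?S n z))"
            by (rule summable_comparison_test'[OF geo[of "\<bar>V z\<bar>"], of 0]) (simp only: real_norm_def abs_idempotent nb[OF z, unfolded real_norm_def])
        qed
        have "(\<integral>z. norm (?S n z) \<partial>\<nu>) \<le> (\<bar>t\<bar> * D) ^ n * (\<integral>z. \<bar>V z\<bar> \<partial>\<nu>)" for n
        proof -
          have "(\<integral>z. norm (?S n z) \<partial>\<nu>) \<le> (\<integral>z. (\<bar>t\<bar> * D) ^ n * \<bar>V z\<bar> \<partial>\<nu>)"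
            by (rule integral_mono) (use int nb V in \<open>auto intro!: integrable_norm\<close>)
          then show ?thesis using V by simp
        qed
        then show "summable (\<lambda>n. \<integral>z. norm (?S n z) \<partial>\<nu>)"
          by (intro summable_comparison_test'[OF geo[of "\<integral>z. \<bar>V z\<bar> \<partial>\<nu>"], of 0])
             (simp only: real_norm_def abs_of_nonneg[OF Bochner_Integration.integral_nonneg[OF abs_ge_zero]])
      qed
      moreover have "(\<integral>z. (\<Sum>n. ?S n z) \<partial>\<nu>) = (\<integral>z. U z * (f z / (a z + t * da z)) \<partial>\<nu>)"
      proof (intro Bochner_Integration.integral_cong refl)
        fix z assume z: "z \<in> space \<nu>"
        have lt: "\<bar>t * d z\<bar> < 1" using bound[OF z] tD by simp
        have a: "a z > 0" using m(7)[OF z] .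
        have "(\<lambda>n. (- t * d z) ^ n) sums (1 / (1 - (- t * d z)))"
          by (rule geometric_sums) (use lt in simp)
        from sums_mult[OF this, of "V z"] have "(\<Sum>n. ?S n z) = V z / (1 + t * d z)"
          by (simp add: sums_iff)
        also have "1 + t * d z = (a z + t * da z) / a z"
          using a by (simp add: d_def field_simps)
        also have "V z / ((a z + t * da z) / a z) = U z * (f z / (a z + t * da z))"
          using a by (simp add: V_def)
        finally show "(\<Sum>n. ?S n z) = U z * (f z / (a z + t * da z))" .
      qed
      moreover have "integral\<^sup>L \<nu> (?S n) = fps_nth F n * t ^ n" for n
      proof -
        have "?S n = (\<lambda>z. (V z * (- d z) ^ n) * t ^ n)"
          by (simp add: fun_eq_iff power_mult_distrib[symmetric] mult_ac)
        then show ?thesis by (simp add: F_def)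
      qed
      ultimately show ?case by simp
    qed
  qed
  then show ?thesis by (auto simp: analytic_order_ge_def)
qed

lemma analytic_integral_g:
  assumes model: "model \<nu> a b f" and d: "bounded_meas \<nu> da" "bounded_meas \<nu> db" "bounded_meas \<nu> df"
    and int: "(\<integral>z. df z * f z \<partial>\<nu>) = 0" and U: "integrable \<nu> U"
  shows "analytic_order_ge 0 (\<lambda>t. \<integral>z. U z * (f z * (1 + t * df z) / (a z + t * da z)) \<partial>\<nu>)"
proof (rule analytic_order_ge_cong)
  note m = modelD[OF model]
  have U': "integrable \<nu> (\<lambda>z. df z * U z)" by (rule bounded_meas_integrable_mult[OF d(3) U])
  let ?R = "\<lambda>U t. \<integral>z. U z * (f z / (a z + t * da z)) \<partial>\<nu>"
  \<comment> \<open>The factor \<open>1 + t * df\<close> is affine in \<open>t\<close>, so the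
    integral splits into two integrals of the previous kind.\<close>
  have "analytic_order_ge 0 (\<lambda>t. t)"
    by (rule analytic_order_ge_mono[OF analytic_order_ge_ident]) simp
  then show "analytic_order_ge 0 (\<lambda>t. ?R U t + t * ?R (\<lambda>z. df z * U z) t)"
    by (intro analytic_order_ge_add analytic_order_ge_mult0 analytic_integral_reciprocal[OF model d(1)] U U')
  from model_perturb[OF model d int]
  show "\<forall>\<^sub>F t in nhds 0. ?R U t + t * ?R (\<lambda>z. df z * U z) t
      = (\<integral>z. U z * (f z * (1 + t * df z) / (a z + t * da z)) \<partial>\<nu>)"
  proof eventually_elim
    case (elim t)
    have bm: "bounded_meas \<nu> (\<lambda>z. f z * (1 / (a z + t * da z)))"
      by (intro bounded_meas_mult m modelD[OF elim])
    have i: "integrable \<nu> (\<lambda>z. V z * (f z / (a z + t * da z)))" if "integrable \<nu> V" for V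
      using bounded_meas_integrable_mult[OF bm that] by (simp add: mult.commute)
    have "?R U t + t * ?R (\<lambda>z. df z * U z) t
      = (\<integral>z. U z * (f z / (a z + t * da z)) + t * (df z * U z * (f z / (a z + t * da z))) \<partial>\<nu>)"
      using i[OF U] i[OF U'] by (simp del: times_divide_eq_right times_divide_eq_left)
    also have "\<dots> = (\<integral>z. U z * (f z * (1 + t * df z) / (a z + t * da z)) \<partial>\<nu>)"
      by (intro Bochner_Integration.integral_cong refl) (simp add: ring_distribs add_divide_distrib mult_ac)
    finally show ?case .
  qed
qed

lemma analytic_integral_mult_g:
  assumes model: "model \<nu> a b f" and d: "bounded_meas \<nu> da" "bounded_meas \<nu> db" "bounded_meas \<nu> df"
    and int: "(\<integral>z. df z * f z \<partial>\<nu>) = 0" and U: "integrable \<nu> U"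
    and h: "bounded_meas \<nu> h" "bounded_meas \<nu> dh"
  shows "analytic_order_ge 0 (\<lambda>t. \<integral>z. (h z + t * dh z) * U z * (f z * (1 + t * df z) / (a z + t * da z)) \<partial>\<nu>)"
proof (rule analytic_order_ge_cong)
  have U1: "integrable \<nu> (\<lambda>z. h z * U z)" and U2: "integrable \<nu> (\<lambda>z. dh z * U z)"
    by (rule bounded_meas_integrable_mult[OF _ U]; fact)+
  let ?R = "\<lambda>U t. \<integral>z. U z * (f z * (1 + t * df z) / (a z + t * da z)) \<partial>\<nu>"
  have "analytic_order_ge 0 (\<lambda>t. t)"
    by (rule analytic_order_ge_mono[OF analytic_order_ge_ident]) simp
  then show "analytic_order_ge 0 (\<lambda>t. ?R (\<lambda>z. h z * U z) t + t * ?R (\<lambda>z. dh z * U z) t)"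
    by (intro analytic_order_ge_add analytic_order_ge_mult0 analytic_integral_g[OF model d int] U1 U2)
  from model_perturb[OF model d int]
  show "\<forall>\<^sub>F t in nhds 0. ?R (\<lambda>z. h z * U z) t + t * ?R (\<lambda>z. dh z * U z) t
      = (\<integral>z. (h z + t * dh z) * U z * (f z * (1 + t * df z) / (a z + t * da z)) \<partial>\<nu>)"
  proof eventually_elim
    case (elim t)
    have i: "integrable \<nu> (\<lambda>z. V z * (f z * (1 + t * df z) / (a z + t * da z)))" if "integrable \<nu> V" for V
      using bounded_meas_integrable_mult[OF modelD(5)[OF elim] that] by (simp add: mult.commute)
    have "?R (\<lambda>z. h z * U z) t + t * ?R (\<lambda>z. dh z * U z) t
      = (\<integral>z. h z * U z * (f z * (1 + t * df z) / (a z + t * da z)) + t * (dh z * U z * (f z * (1 + t * df z) / (a z + t * da z))) \<partial>\<nu>)"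
      using i[OF U1] i[OF U2] by (simp del: times_divide_eq_right times_divide_eq_left)
    also have "\<dots> = (\<integral>z. (h z + t * dh z) * U z * (f z * (1 + t * df z) / (a z + t * da z)) \<partial>\<nu>)"
      by (intro Bochner_Integration.integral_cong refl) (simp add: distrib_right add_divide_distrib mult.assoc)
    finally show ?case .
  qed
qed

section \<open>The approximate functional\<close>

locale approx_functional = L2_space \<nu> L k e
  for \<nu> :: "'z measure" and L k e +
  fixes ahat au bhat bu :: "'z \<Rightarrow> real"
  assumes hats: "bounded_meas \<nu> ahat" "bounded_meas \<nu> bhat"
    and au: "bounded_meas \<nu> au" "bounded_away \<nu> {0<..} au"
    and bu: "bounded_meas \<nu> bu" "bounded_away \<nu> {0<..} bu"
begin

lemma atilde_orthogonal:
  assumes "model \<nu> a b f"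
  obtains u where "u \<in> L" "\<And>z. atilde \<nu> ahat au bu L a f z = ahat z + au z * u z"
    "\<And>v. v \<in> L \<Longrightarrow> (\<integral>z. (a z - atilde \<nu> ahat au bu L a f z) * v z * (bu z * (f z / a z)) \<partial>\<nu>) = 0"
  unfolding atilde_def
  by (rule tilde_orthogonal[OF au bu hats(1) modelD(2)[OF assms] modelD(5)[OF assms], of "weight au bu a f"])
     (use modelD[OF assms] in \<open>auto simp: weight_def\<close>)

lemma btilde_orthogonal:
  assumes "model \<nu> a b f"
  obtains u where "u \<in> L" "\<And>z. btilde \<nu> bhat au bu L a b f z = bhat z + bu z * u z"
    "\<And>v. v \<in> L \<Longrightarrow> (\<integral>z. (b z - btilde \<nu> bhat au bu L a b f z) * v z * (au z * (f z / a z)) \<partial>\<nu>) = 0"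
  unfolding btilde_def
  by (rule tilde_orthogonal[OF bu au hats(2) modelD(3)[OF assms] modelD(5)[OF assms], of "weight au bu a f"])
     (use modelD[OF assms] in \<open>auto simp: weight_def\<close>)

lemma sq_int_atilde:
  assumes "model \<nu> a b f"
  shows "sq_int \<nu> (atilde \<nu> ahat au bu L a f)"
proof -
  obtain u where u: "u \<in> L" "\<And>z. atilde \<nu> ahat au bu L a f z = ahat z + au z * u z"
    using atilde_orthogonal[OF assms] by metis
  have "sq_int \<nu> (\<lambda>z. ahat z + au z * u z)"
    by (intro sq_int_add sq_int_bounded_mult bounded_meas_sq_int hats au sq_int_L u)
  then show ?thesis by (simp add: u(2)[symmetric])
qed

lemma sq_int_btilde:
  assumes "model \<nu> a b f"
  shows "sq_int \<nu> (btilde \<nu> bhat au bu L a b f)"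
proof -
  obtain u where u: "u \<in> L" "\<And>z. btilde \<nu> bhat au bu L a b f z = bhat z + bu z * u z"
    using btilde_orthogonal[OF assms] by metis
  have "sq_int \<nu> (\<lambda>z. bhat z + bu z * u z)"
    by (intro sq_int_add sq_int_bounded_mult bounded_meas_sq_int hats bu sq_int_L u)
  then show ?thesis by (simp add: u(2)[symmetric])
qed

lemma score_integral:
  assumes model: "model \<nu> a' b' f'" and s: "sq_int \<nu> s" "sq_int \<nu> r"
  shows "has_bochner_integral (law \<nu> a' b' f') (score s r)
    (\<integral>z. (b' z * s z - s z * r z + a' z * r z) * (f' z / a' z) \<partial>\<nu>)"
proof -
  have "integrable \<nu> (\<lambda>z. - (s z * r z))" using sq_int_mult_integrable[OF s] by simp
  from law_integral[OF model sq_int_integrable[OF s(1)] this sq_int_integrable[OF s(2)]]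
  show ?thesis by (simp add: score_def[abs_def] algebra_simps)
qed

text \<open>Closed form of the mean of \<open>A_tilde * e p\<close> under another law:
  \<open>s\<close> remains the approximation at the original law, while \<open>a'\<close> and
  \<open>f'\<close> move. \<open>coef_b\<close> does the same for \<open>Y_tilde\<close>.\<close>

definition coef_a where
  "coef_a s a' f' p = (\<integral>z. (s z - a' z) * e p z * (bu z * (f' z / a' z)) \<partial>\<nu>)"

definition coef_b where
  "coef_b r a' b' f' p = (\<integral>z. (b' z - r z) * e p z * (au z * (f' z / a' z)) \<partial>\<nu>)"

abbreviation "gram_at a f \<equiv> gram \<nu> (weight au bu a f) k e"

lemma bounded_weight: "model \<nu> a b f \<Longrightarrow> bounded_meas \<nu> (weight au bu a f)"
  unfolding weight_def[abs_def] by (intro bounded_meas_mult au bu modelD)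

lemma weight_pos:
  assumes "model \<nu> a b f" "z \<in> space \<nu>"
  shows "0 < weight au bu a f z"
proof -
  have "0 < au z" "0 < bu z" using au bu assms(2) by (force simp: bounded_away_def)+
  then show ?thesis using modelD(7,9)[OF assms] by (simp add: weight_def)
qed

lemma gram_at_det: "model \<nu> a b f \<Longrightarrow> Determinant.det (gram_at a f) \<noteq> 0"
  by (rule gram_det_nonzero) (auto intro: bounded_weight weight_pos)

lemma A_integral:
  assumes model: "model \<nu> a' b' f'" and u: "integrable \<nu> u"
  shows "has_bochner_integral (law \<nu> a' b' f') (\<lambda>x. obs_A x * u (obs_Z x)) (\<integral>z. u z * (f' z / a' z) \<partial>\<nu>)"
  using law_integral[OF model _ u, of "\<lambda>z. 0" "\<lambda>z. 0"] by simp

lemma A_tilde_integral: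
  assumes model: "model \<nu> a b f" and model': "model \<nu> a' b' f'" and p: "p < k"
  shows "has_bochner_integral (law \<nu> a' b' f') (\<lambda>x. A_tilde \<nu> ahat au bu L a f x * e p (obs_Z x))
    (coef_a (atilde \<nu> ahat au bu L a f) a' f' p)"
proof -
  note e = sq_int_L[OF basis_in_L[OF p]]
  have i: "integrable \<nu> (\<lambda>z. bu z * (atilde \<nu> ahat au bu L a f z * e p z))" "integrable \<nu> (\<lambda>z. bu z * (- e p z))"
    by (intro bounded_meas_integrable_mult bu sq_int_mult_integrable sq_int_atilde[OF model] e
        Bochner_Integration.integrable_minus sq_int_integrable)+
  from law_integral[OF model' _ i, of "\<lambda>z. 0"]
  show ?thesis by (simp add: A_tilde_def[abs_def] coef_a_def algebra_simps)
qed

lemma Y_tilde_integral: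
  assumes model: "model \<nu> a b f" and model': "model \<nu> a' b' f'" and p: "p < k"
  shows "has_bochner_integral (law \<nu> a' b' f') (\<lambda>x. Y_tilde \<nu> bhat au bu L a b f x * e p (obs_Z x))
    (coef_b (btilde \<nu> bhat au bu L a b f) a' b' f' p)"
proof -
  note e = sq_int_L[OF basis_in_L[OF p]]
  have i: "integrable \<nu> (\<lambda>z. au z * e p z)" "integrable \<nu> (\<lambda>z. au z * (- (btilde \<nu> bhat au bu L a b f z * e p z)))"
    by (intro bounded_meas_integrable_mult au sq_int_mult_integrable sq_int_btilde[OF model] e
        Bochner_Integration.integrable_minus sq_int_integrable)+
  from law_integral[OF model' i, of "\<lambda>z. 0"]
  show ?thesis by (simp add: Y_tilde_def[abs_def] coef_b_def algebra_simps)
qed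

lemma A_und_integral:
  assumes model': "model \<nu> a' b' f'" and p: "p < k" and r: "r < k"
  shows "has_bochner_integral (law \<nu> a' b' f') (\<lambda>x. A_und au bu x * e r (obs_Z x) * e p (obs_Z x))
    (gram_at a' f' $$ (r, p))"
proof -
  have "integrable \<nu> (\<lambda>z. (au z * bu z) * (e r z * e p z))"
    by (intro bounded_meas_integrable_mult bounded_meas_mult au bu sq_int_mult_integrable sq_int_L basis_in_L p r)
  from A_integral[OF model' this]
  show ?thesis by (simp add: A_und_def[abs_def] gram_index p r weight_def mult_ac)
qed

text \<open>Orthogonality tested against a basis function. It centres \<open>A_tilde * e p\<close>
  at the original law, so that integrating against a difference of laws equals integrating against
  the new one.\<close>

lemma coef_a_self:
  assumes "model \<nu> a b f" "p < k"
  shows "coef_a (atilde \<nu> ahat au bu L a f) a f p = 0"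
proof -
  obtain u where "\<And>v. v \<in> L \<Longrightarrow> (\<integral>z. (a z - atilde \<nu> ahat au bu L a f z) * v z * (bu z * (f z / a z)) \<partial>\<nu>) = 0"
    using atilde_orthogonal[OF assms(1)] by metis
  from this[OF basis_in_L[OF assms(2)]]
  have "- (\<integral>z. (a z - atilde \<nu> ahat au bu L a f z) * e p z * (bu z * (f z / a z)) \<partial>\<nu>) = 0" by simp
  then show ?thesis
    unfolding coef_a_def Bochner_Integration.integral_minus[symmetric] by (simp add: algebra_simps)
qed

lemma coef_b_self:
  assumes "model \<nu> a b f" "p < k"
  shows "coef_b (btilde \<nu> bhat au bu L a b f) a b f p = 0"
proof -
  obtain u where "\<And>v. v \<in> L \<Longrightarrow> (\<integral>z. (b z - btilde \<nu> bhat au bu L a b f z) * v z * (au z * (f z / a z)) \<partial>\<nu>) = 0"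
    using btilde_orthogonal[OF assms(1)] by metis
  from this[OF basis_in_L[OF assms(2)]] show ?thesis by (simp add: coef_b_def)
qed

text \<open>\<open>\<gamma>\<close> is the coordinate vector of the increment of \<open>btilde / bu\<close>; by orthogonality only the product of
  the increments of \<open>atilde\<close> and \<open>btilde\<close> survives.\<close>

lemma chi_tilde_expansion:
  assumes model: "model \<nu> a b f" and model': "model \<nu> a' b' f'"
  defines "ta \<equiv> atilde \<nu> ahat au bu L a f" and "tb \<equiv> btilde \<nu> bhat au bu L a b f"
  defines "\<gamma> p \<equiv> (\<Sum>q<k. adj_mat (gram_at a' f') $$ (p, q) * coef_b tb a' b' f' q) * inverse (Determinant.det (gram_at a' f'))"
  shows "chi_tilde \<nu> ahat au bhat bu L a' b' f' =
      (\<integral>x. score ta tb x \<partial>law \<nu> a' b' f') - (\<Sum>p<k. coef_a ta a' f' p * \<gamma> p)"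
proof -
  define ta' where "ta' = atilde \<nu> ahat au bu L a' f'"
  define tb' where "tb' = btilde \<nu> bhat au bu L a' b' f'"
  define g' where "g' z = f' z / a' z" for z
  note m = modelD[OF model']
  have g': "bounded_meas \<nu> g'" unfolding g'_def[abs_def] by (rule m)
  obtain u where u: "u \<in> L" "\<And>z. ta z = ahat z + au z * u z"
    and "\<And>v. v \<in> L \<Longrightarrow> (\<integral>z. (a z - ta z) * v z * (bu z * (f z / a z)) \<partial>\<nu>) = 0"
    by (rule atilde_orthogonal[OF model, folded ta_def], rule that)
  obtain u' where u': "u' \<in> L" "\<And>z. ta' z = ahat z + au z * u' z"
    and "\<And>v. v \<in> L \<Longrightarrow> (\<integral>z. (a' z - ta' z) * v z * (bu z * g' z) \<partial>\<nu>) = 0"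
    by (rule atilde_orthogonal[OF model', folded ta'_def g'_def], rule that)
  obtain v where v: "v \<in> L" "\<And>z. tb z = bhat z + bu z * v z"
    and "\<And>v. v \<in> L \<Longrightarrow> (\<integral>z. (b z - tb z) * v z * (au z * (f z / a z)) \<partial>\<nu>) = 0"
    by (rule btilde_orthogonal[OF model, folded tb_def], rule that)
  obtain v' where v': "v' \<in> L" "\<And>z. tb' z = bhat z + bu z * v' z"
    and orth_v': "\<And>v. v \<in> L \<Longrightarrow> (\<integral>z. (b' z - tb' z) * v z * (au z * g' z) \<partial>\<nu>) = 0"
    by (rule btilde_orthogonal[OF model', folded tb'_def g'_def], rule that)
  have sq: "sq_int \<nu> ta" "sq_int \<nu> tb" "sq_int \<nu> ta'" "sq_int \<nu> tb'"
    unfolding ta_def tb_def ta'_def tb'_def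
    by (intro sq_int_atilde[OF model] sq_int_btilde[OF model] sq_int_atilde[OF model'] sq_int_btilde[OF model'])+
  have sqm: "sq_int \<nu> a'" "sq_int \<nu> b'" by (intro bounded_meas_sq_int m)+
  define du where "du z = u' z - u z" for z
  define dv where "dv z = v' z - v z" for z
  have duL: "du \<in> L" and dvL: "dv \<in> L"
    unfolding du_def[abs_def] dv_def[abs_def] by (intro L_diff u u' v v')+
  obtain c where c: "AE z in \<nu>. dv z = (\<Sum>i<k. c i * e i z)"
    using basis dvL unfolding L2_basis_def by blast
  have bu_g: "bounded_meas \<nu> (\<lambda>z. bu z * g' z)" and au_g: "bounded_meas \<nu> (\<lambda>z. au z * g' z)"
    by (intro bounded_meas_mult au bu g')+
  have e: "sq_int \<nu> (e p)" if "p < k" for p by (rule sq_int_L[OF basis_in_L[OF that]])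
  have dv: "dv \<in> borel_measurable \<nu>" using sq_int_L[OF dvL] by (simp add: sq_int_def)
  \<comment> \<open>The normal equations of the increment \<open>dv\<close> under the new law. The
    new residual \<open>b' - tb'\<close> is orthogonal to \<open>L\<close>, so only the old residual
    \<open>b' - tb\<close> contributes.\<close>
  have "\<forall>p<k. (\<Sum>q<k. gram_at a' f' $$ (p, q) * c q) = coef_b tb a' b' f' p"
  proof (intro allI impI)
    fix p assume p: "p < k"
    have "(\<Sum>q<k. gram_at a' f' $$ (p, q) * c q) = (\<integral>z. e p z * dv z * weight au bu a' f' z \<partial>\<nu>)"
      by (subst integral_basis_expansion[OF e[OF p] bounded_weight[OF model'] c dv])
         (auto intro!: sum.cong simp: gram_index p)
    also have "\<dots> = (\<integral>z. (b' z - tb z) * e p z * (au z * g' z) - (b' z - tb' z) * e p z * (au z * g' z) \<partial>\<nu>)"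
      by (intro Bochner_Integration.integral_cong refl)
         (simp add: weight_def dv_def v v' g'_def[symmetric] algebra_simps)
    also have "\<dots> = coef_b tb a' b' f' p - (\<integral>z. (b' z - tb' z) * e p z * (au z * g' z) \<partial>\<nu>)"
      unfolding coef_b_def g'_def[symmetric]
      by (intro Bochner_Integration.integral_diff sq_int_weighted_integrable sq_int_diff sq sqm e p au_g)
    also have "(\<integral>z. (b' z - tb' z) * e p z * (au z * g' z) \<partial>\<nu>) = 0"
      by (rule orth_v'[OF basis_in_L[OF p]])
    finally show "(\<Sum>q<k. gram_at a' f' $$ (p, q) * c q) = coef_b tb a' b' f' p" by simp
  qed
  then have c_eq: "c p = \<gamma> p" if "p < k" for p
    using that unfolding solve_adj_mat[OF gram_carrier gram_at_det[OF model']] \<gamma>_def by blast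
  let ?s = "\<lambda>s r z. (b' z * s z - s z * r z + a' z * r z) * g' z"
  have int_s: "integrable \<nu> (?s s r)" if "sq_int \<nu> s" "sq_int \<nu> r" for s r
    using bounded_meas_integrable_mult[OF g', of "\<lambda>z. b' z * s z - s z * r z + a' z * r z"] that
    by (simp add: mult.commute sq_int_mult_integrable sqm)
  have "chi_tilde \<nu> ahat au bhat bu L a' b' f' - (\<integral>x. score ta tb x \<partial>law \<nu> a' b' f')
      = (\<integral>z. ?s ta' tb' z \<partial>\<nu>) - (\<integral>z. ?s ta tb z \<partial>\<nu>)"
    using score_integral[OF model' sq(3,4)] score_integral[OF model' sq(1,2)]
    unfolding chi_tilde_def ta'_def[symmetric] tb'_def[symmetric] g'_def
    by (simp add: has_bochner_integral_iff)
  also have "\<dots> = (\<integral>z. ?s ta' tb' z - ?s ta tb z \<partial>\<nu>)"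
    by (intro Bochner_Integration.integral_diff[symmetric] int_s sq)
  \<comment> \<open>The score mean is affine in each approximation separately: the difference is
    taken first in \<open>a\<close> at \<open>tb'\<close>, then in \<open>b\<close> at
    \<open>ta\<close>. The increments are \<open>au * du\<close> and \<open>bu * dv\<close>, which
    supplies the weights, and orthogonality under the new law removes the first part.\<close>
  also have "\<dots> = (\<integral>z. (b' z - tb' z) * du z * (au z * g' z) - (ta z - a' z) * dv z * (bu z * g' z) \<partial>\<nu>)"
    by (intro Bochner_Integration.integral_cong refl) (simp add: du_def dv_def u u' v v' algebra_simps)
  also have "\<dots> = (\<integral>z. (b' z - tb' z) * du z * (au z * g' z) \<partial>\<nu>) - (\<integral>z. (ta z - a' z) * dv z * (bu z * g' z) \<partial>\<nu>)"
    by (intro Bochner_Integration.integral_diff sq_int_weighted_integrable sq_int_diff sq sqm sq_int_L duL dvL bu_g au_g)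
  also have "(\<integral>z. (b' z - tb' z) * du z * (au z * g' z) \<partial>\<nu>) = 0"
    by (rule orth_v'[OF duL])
  also have "(\<integral>z. (ta z - a' z) * dv z * (bu z * g' z) \<partial>\<nu>) = (\<Sum>p<k. coef_a ta a' f' p * \<gamma> p)"
    by (subst integral_basis_expansion[OF sq_int_diff[OF sq(1) sqm(1)] bu_g c dv])
       (auto intro!: sum.cong simp: coef_a_def g'_def c_eq)
  finally show ?thesis by simp
qed

end

section \<open>Means of the influence functions along a path\<close>

lemma integral_iid_1:
  fixes u :: "'x \<Rightarrow> real"
  assumes "prob_space P" "integrable P u"
  shows "(\<integral>x. u (x 1) \<partial>iid 1 P) = (\<integral>y. u y \<partial>P)"
  using iid_integral_prod(2)[OF assms(1), of 1 "\<lambda>_. u"] assms(2) by simp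

context approx_functional
begin

text \<open>Orders start at 2, hence the shift: observation 1 carries \<open>A_tilde\<close>,
  observation \<open>n + 2\<close> carries \<open>Y_tilde\<close>, and the \<open>n\<close> between
  them carry the Gram integrands. Read as a tensor sum, the chain is evaluated by
  \<open>degenerate_part_integral\<close>.\<close>

lemma influence_integral:
  assumes model: "model \<nu> a b f" and model': "model \<nu> a' b' f'"
  defines "ta \<equiv> atilde \<nu> ahat au bu L a f" and "tb \<equiv> btilde \<nu> bhat au bu L a b f"
  defines "K p q \<equiv> the (mat_inverse (gram_at a f)) $$ (p, q)"
  defines "M r p \<equiv> gram_at a' f' $$ (r, p) - gram_at a f $$ (r, p)"
  shows "(\<integral>x. degenerate_part (law \<nu> a b f) (n + 2) (\<lambda>x. (-1) ^ (n + 2 - 1) * fact (n + 2) *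
      (A_tilde \<nu> ahat au bu L a f (x 1)
       * (\<Prod>i=1..<n + 2. proj_kernel \<nu> (weight au bu a f) k e (obs_Z (x i)) (obs_Z (x (i + 1))))
       * (\<Prod>i=2..<n + 2. A_und au bu (x i)) * Y_tilde \<nu> bhat au bu L a b f (x (n + 2)))) x
      \<partial>iid (n + 2) (law \<nu> a' b' f'))
    = fact (n + 2) * ((-1) ^ (n + 1) * (\<Sum>q<k. row_chain k K (coef_a ta a' f') (\<lambda>_. M) n q * coef_b tb a' b' f' q))"
proof -
  let ?P = "law \<nu> a b f" and ?Q = "law \<nu> a' b' f'"
  let ?Ker = "proj_kernel \<nu> (weight au bu a f) k e"
  let ?At = "A_tilde \<nu> ahat au bu L a f" and ?Yt = "Y_tilde \<nu> bhat au bu L a b f"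
  let ?v = "\<lambda>r p x. A_und au bu x * e r (obs_Z x) * e p (obs_Z x)"
  let ?R = "\<lambda>x. row_chain k K (\<lambda>p. ?At (x 1) * e p (obs_Z (x 1))) (\<lambda>i r p. ?v r p (x (i + 2))) n"
  let ?\<rho> = "row_chain k K (coef_a ta a' f') (\<lambda>_. M) n"
  let ?c = "(-1) ^ (n + 1) * fact (n + 2) :: real"
  note A = A_tilde_integral[OF model model, folded ta_def] A_tilde_integral[OF model model', folded ta_def]
  note Y = Y_tilde_integral[OF model model, folded tb_def] Y_tilde_integral[OF model model', folded tb_def]
  note U = A_und_integral[OF model] A_und_integral[OF model']
  have Ker: "?Ker y z = (\<Sum>p<k. \<Sum>q<k. K p q * e p y * e q z)" for y z
    by (simp add: proj_kernel_def K_def)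
  \<comment> \<open>The means under \<open>P\<close> drop out of the first factor because it is
    centred there; in the middle factors they turn the Gram matrix into its increment
    \<open>M\<close>.\<close>
  have row_eq: "row_chain k K (\<lambda>p. (\<integral>y. ?At y * e p (obs_Z y) \<partial>?Q) - (\<integral>y. ?At y * e p (obs_Z y) \<partial>?P))
     (\<lambda>_ r p. (\<integral>y. ?v r p y \<partial>?Q) - (\<integral>y. ?v r p y \<partial>?P)) n q = ?\<rho> q" if "q < k" for q
    using that
  proof (induction n arbitrary: q)
    case 0
    show ?case
      using A coef_a_self[OF model, folded ta_def] by (simp add: has_bochner_integral_iff)
  next
    case (Suc n)
    then show ?case
      using U by (simp add: has_bochner_integral_iff M_def)
  qed
  have "tensor_sum ?P ?Q (n + 2) (\<lambda>x. \<Sum>q<k. ?R x q * (e q (obs_Z (x (n + 2))) * ?Yt (x (n + 2))))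
     (\<Sum>q<k. ?\<rho> q * coef_b tb a' b' f' q)"
  proof (rule tensor_sum_sum)
    fix q assume "q \<in> {..<k}"
    then have q: "q < k" by simp
    have R: "tensor_sum ?P ?Q (Suc n) (\<lambda>x. ?R x q) (?\<rho> q)"
      using row_chain_tensor_sum[where k = k and P = ?P and Q = ?Q and u = "\<lambda>p x. ?At x * e p (obs_Z x)"
          and v = ?v and K = K and n = n, OF _ _ q] A U
      unfolding row_eq[OF q] by (simp add: has_bochner_integral_iff)
    have "(\<integral>y. e q (obs_Z y) * ?Yt y \<partial>?Q) - (\<integral>y. e q (obs_Z y) * ?Yt y \<partial>?P) = coef_b tb a' b' f' q"
      using Y[OF q] coef_b_self[OF model q, folded tb_def] by (simp add: has_bochner_integral_iff mult.commute)
    with tensor_sum_extend[OF R, of "\<lambda>y. e q (obs_Z y) * ?Yt y"] Y[OF q]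
    show "tensor_sum ?P ?Q (n + 2) (\<lambda>x. ?R x q * (e q (obs_Z (x (n + 2))) * ?Yt (x (n + 2)))) (?\<rho> q * coef_b tb a' b' f' q)"
      by (simp add: has_bochner_integral_iff mult.commute)
  qed auto
  then have "tensor_sum ?P ?Q (n + 2) (\<lambda>x. (\<Sum>q<k. ?R x q * (e q (obs_Z (x (n + 2))) * ?Yt (x (n + 2)))) * ?c)
     ((\<Sum>q<k. ?\<rho> q * coef_b tb a' b' f' q) * ?c)"
    by (rule tensor_sum_scale[rotated]) simp
  moreover have "(\<Sum>q<k. ?R x q * (e q (obs_Z (x (n + 2))) * ?Yt (x (n + 2)))) * ?c
    = (-1) ^ (n + 2 - 1) * fact (n + 2) * (?At (x 1)
       * (\<Prod>i=1..<n + 2. ?Ker (obs_Z (x i)) (obs_Z (x (i + 1))))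
       * (\<Prod>i=2..<n + 2. A_und au bu (x i)) * ?Yt (x (n + 2)))" for x
  proof -
    have "(\<Sum>q<k. ?R x q * (e q (obs_Z (x (n + 2))) * ?Yt (x (n + 2))))
      = (\<Sum>q<k. ?R x q * e q (obs_Z (x (n + 2)))) * ?Yt (x (n + 2))"
      by (simp add: sum_distrib_right mult.assoc)
    also have "(\<Sum>q<k. ?R x q * e q (obs_Z (x (n + 2)))) = ?At (x 1) * (\<Prod>i=1..<n + 1. ?Ker (obs_Z (x i)) (obs_Z (x (i + 1))))
        * (\<Prod>i=2..<n + 2. A_und au bu (x i)) * ?Ker (obs_Z (x (n + 1))) (obs_Z (x (n + 2)))"
      by (rule row_chain_kernel[where Ker = ?Ker and e = e and z = "\<lambda>i. obs_Z (x i)" and A = "\<lambda>i. A_und au bu (x i)", OF Ker])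
    finally show ?thesis by (simp add: prod.atLeastLessThan_Suc mult_ac)
  qed
  ultimately have "tensor_sum ?P ?Q (n + 2) (\<lambda>x. (-1) ^ (n + 2 - 1) * fact (n + 2) * (?At (x 1)
       * (\<Prod>i=1..<n + 2. ?Ker (obs_Z (x i)) (obs_Z (x (i + 1))))
       * (\<Prod>i=2..<n + 2. A_und au bu (x i)) * ?Yt (x (n + 2))))
     ((\<Sum>q<k. ?\<rho> q * coef_b tb a' b' f' q) * ?c)"
    by (simp only:)
  from degenerate_part_integral[OF prob_space_law[OF model] prob_space_law[OF model'] _ absolutely_continuous_law[OF model model'] this]
  show ?thesis by (simp add: sets_law has_bochner_integral_iff mult_ac)
qed

lemma influence_functions_chi_tilde:
  assumes model: "model \<nu> a b f"
  shows "influence_functions \<nu> (chi_tilde \<nu> ahat au bhat bu L) a b f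
    (\<lambda>m. if m = 1 then (\<lambda>x. chi_tilde_1 \<nu> ahat au bhat bu L a b f (x 1))
         else degenerate_part (law \<nu> a b f) m (\<lambda>x. (-1) ^ (m - 1) * fact m *
                (A_tilde \<nu> ahat au bu L a f (x 1)
                 * (\<Prod>i=1..<m. proj_kernel \<nu> (weight au bu a f) k e (obs_Z (x i)) (obs_Z (x (i + 1))))
                 * (\<Prod>i=2..<m. A_und au bu (x i)) * Y_tilde \<nu> bhat au bu L a b f (x m))))"
  (is "influence_functions _ _ _ _ _ ?infl")
  unfolding influence_functions_def Let_def
proof (intro allI impI)
  fix m j :: nat and da db df :: "'z \<Rightarrow> real"
  assume j: "1 \<le> j" "j \<le> m"
    and d: "bounded_meas \<nu> da" "bounded_meas \<nu> db" "bounded_meas \<nu> df"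
    and int: "(\<integral>z. df z * f z \<partial>\<nu>) = 0"
  define a' where "a' t z = a z + t * da z" for t z
  define b' where "b' t z = b z + t * db z" for t z
  define f' where "f' t z = f z * (1 + t * df z)" for t z
  note m = modelD[OF model]
  have ev: "\<forall>\<^sub>F t in nhds 0. model \<nu> (a' t) (b' t) (f' t)"
    using model_perturb[OF model d int] unfolding a'_def b'_def f'_def .
  define ta where "ta = atilde \<nu> ahat au bu L a f"
  define tb where "tb = btilde \<nu> bhat au bu L a b f"
  have sq: "sq_int \<nu> ta" "sq_int \<nu> tb"
    unfolding ta_def tb_def by (intro sq_int_atilde[OF model] sq_int_btilde[OF model])+
  define K where "K p q = the (mat_inverse (gram_at a f)) $$ (p, q)" for p q
  define G where "G t = gram_at (a' t) (f' t)" for t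
  define C where "C r p = gram_at a f $$ (r, p)" for r p
  define M where "M t r p = G t $$ (r, p) - C r p" for t r p
  define \<alpha> where "\<alpha> t = coef_a ta (a' t) (f' t)" for t
  define \<beta> where "\<beta> t = coef_b tb (a' t) (b' t) (f' t)" for t
  define \<gamma> where "\<gamma> t p = (\<Sum>q<k. adj_mat (G t) $$ (p, q) * \<beta> t q) * inverse (Determinant.det (G t))" for t p
  define \<sigma> where "\<sigma> t = (\<integral>z. (b' t z * ta z - ta z * tb z + a' t z * tb z) * (f' t z / a' t z) \<partial>\<nu>)" for t
  \<comment> \<open>The centring constant of \<open>chi_tilde_1\<close>, taken at the fixed law and
    hence independent of \<open>t\<close>.\<close>
  define \<chi>0 where "\<chi>0 = (\<integral>z. ta z * tb z * (f z / a z) \<partial>\<nu>)"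
  define \<psi> where "\<psi> t = (\<Sum>i=1..m. 1 / fact i * (\<integral>x. ?infl i x \<partial>iid i (law \<nu> (a' t) (b' t) (f' t))))" for t
  let ?row = "\<lambda>t. row_chain k K (\<alpha> t) (\<lambda>_. M t)"
  \<comment> \<open>Orders \<open>2, ..., m\<close> supply the Neumann terms
    \<open>0, ..., m - 2\<close>, so the exact remainder is the one after \<open>m - 1\<close>
    terms.\<close>
  define \<rho> where "\<rho> t = (-1) ^ (m - 1) * (\<Sum>q<k. ?row t (m - 1) q * (\<Sum>r<k. C q r * \<gamma> t r))" for t

  have at0: "a' 0 = a" "b' 0 = b" "f' 0 = f" by (simp_all add: a'_def b'_def f'_def fun_eq_iff)
  have G_carrier: "G t \<in> carrier_mat k k" for t unfolding G_def by (rule gram_carrier)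
  have KC: "(\<Sum>q<k. K p q * C q r) = of_bool (p = r)" if "p < k" "r < k" for p r
    unfolding K_def C_def by (rule mat_inverse_left_inverse[OF gram_carrier gram_at_det[OF model] that])

  have \<psi>_eq: "\<psi> t = \<sigma> t - \<chi>0 - (\<Sum>n<m - 1. (-1) ^ n * (\<Sum>q<k. ?row t n q * \<beta> t q))"
    if model': "model \<nu> (a' t) (b' t) (f' t)" for t
  proof -
    let ?Q = "law \<nu> (a' t) (b' t) (f' t)"
    interpret Q: prob_space ?Q by (rule prob_space_law[OF model'])
    note score = score_integral[OF model' sq]
    have "(\<integral>x. ?infl 1 x \<partial>iid 1 ?Q) = (\<integral>x. score ta tb x - \<chi>0 \<partial>?Q)"
      using integral_iid_1[OF Q.prob_space_axioms, of "\<lambda>x. score ta tb x - \<chi>0"] score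
      by (simp add: chi_tilde_1_def ta_def tb_def \<chi>0_def has_bochner_integral_iff)
    also have "\<dots> = \<sigma> t - \<chi>0"
      using score by (simp add: has_bochner_integral_iff \<sigma>_def Q.prob_space)
    finally have first: "(\<integral>x. ?infl 1 x \<partial>iid 1 ?Q) = \<sigma> t - \<chi>0" .
    have shift: "(\<Sum>i=2..m. T i) = (\<Sum>n<m - 1. T (n + 2))" for T :: "nat \<Rightarrow> real"
    proof (rule sum.reindex_bij_witness[of _ "\<lambda>n. n + 2" "\<lambda>i. i - 2"])
      fix i assume "i \<in> {2..m}"
      then show "T (i - 2 + 2) = T i" by (simp only: le_add_diff_inverse2 atLeastAtMost_iff)
    qed auto
    have "\<psi> t = (\<integral>x. ?infl 1 x \<partial>iid 1 ?Q) + (\<Sum>i=2..m. 1 / fact i * (\<integral>x. ?infl i x \<partial>iid i ?Q))"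
      unfolding \<psi>_def using j by (subst sum.atLeast_Suc_atMost) (auto simp: numeral_2_eq_2)
    also have "(\<Sum>i=2..m. 1 / fact i * (\<integral>x. ?infl i x \<partial>iid i ?Q))
      = (\<Sum>n<m - 1. 1 / fact (n + 2) * (\<integral>x. ?infl (n + 2) x \<partial>iid (n + 2) ?Q))"
      by (rule shift)
    also have "\<dots> = (\<Sum>n<m - 1. - ((-1) ^ n * (\<Sum>q<k. ?row t n q * \<beta> t q)))"
    proof (intro sum.cong refl)
      fix n
      have "?infl (n + 2) = degenerate_part (law \<nu> a b f) (n + 2) (\<lambda>x. (-1) ^ (n + 2 - 1) * fact (n + 2) *
      (A_tilde \<nu> ahat au bu L a f (x 1)
       * (\<Prod>i=1..<n + 2. proj_kernel \<nu> (weight au bu a f) k e (obs_Z (x i)) (obs_Z (x (i + 1))))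
       * (\<Prod>i=2..<n + 2. A_und au bu (x i)) * Y_tilde \<nu> bhat au bu L a b f (x (n + 2))))"
        by simp
      then have "(\<integral>x. ?infl (n + 2) x \<partial>iid (n + 2) ?Q) = fact (n + 2) * ((-1) ^ (n + 1) * (\<Sum>q<k. ?row t n q * \<beta> t q))"
        unfolding \<alpha>_def \<beta>_def M_def G_def C_def K_def ta_def tb_def
        by (simp only: influence_integral[OF model model'])
      then show "1 / fact (n + 2) * (\<integral>x. ?infl (n + 2) x \<partial>iid (n + 2) ?Q) = - ((-1) ^ n * (\<Sum>q<k. ?row t n q * \<beta> t q))"
        by (simp only:) simp
    qed
    finally show ?thesis by (simp only: first sum_negf diff_conv_add_uminus)
  qed

  \<comment> \<open>The score mean \<open>\<sigma>\<close> is common to the functional and to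
    \<open>\<psi>\<close>, and the Neumann identity matches the rest, so the two differ by a
    constant and the remainder.\<close>
  have chi_eq: "chi_tilde \<nu> ahat au bhat bu L (a' t) (b' t) (f' t) = \<chi>0 + \<psi> t + - \<rho> t"
    if model': "model \<nu> (a' t) (b' t) (f' t)" for t
  proof -
    have solve: "(\<Sum>q<k. (C p q + M t p q) * \<gamma> t q) = \<beta> t p" if "p < k" for p
      using iffD2[OF solve_adj_mat[OF gram_carrier gram_at_det[OF model']], of "\<gamma> t" "\<beta> t"] that
      by (simp add: M_def \<gamma>_def G_def)
    have "chi_tilde \<nu> ahat au bhat bu L (a' t) (b' t) (f' t) = \<sigma> t - (\<Sum>p<k. \<alpha> t p * \<gamma> t p)"
      using chi_tilde_expansion[OF model model'] score_integral[OF model' sq]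
      by (simp add: \<alpha>_def \<gamma>_def \<beta>_def G_def ta_def tb_def \<sigma>_def has_bochner_integral_iff)
    also have "(\<Sum>p<k. \<alpha> t p * \<gamma> t p) = (\<Sum>n<m - 1. (-1) ^ n * (\<Sum>q<k. ?row t n q * \<beta> t q)) + \<rho> t"
      using row_chain_neumann[of k K C "M t" "\<gamma> t" "\<beta> t" "\<alpha> t" "m - 1", OF KC solve]
      by (simp add: \<rho>_def)
    finally show ?thesis by (simp add: \<psi>_eq[OF model'])
  qed

  note an_g = analytic_integral_g[OF model d int]
  note an_h = analytic_integral_mult_g[OF model d int]
  note e = sq_int_L[OF basis_in_L]
  have an_G: "analytic_order_ge 0 (\<lambda>t. G t $$ (r, p))" if "r < k" "p < k" for r p
  proof -
    have "integrable \<nu> (\<lambda>z. (au z * bu z) * (e r z * e p z))"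
      by (intro bounded_meas_integrable_mult bounded_meas_mult au bu sq_int_mult_integrable e that)
    from an_g[OF this] show ?thesis
      by (simp add: G_def gram_index that weight_def a'_def f'_def mult_ac)
  qed
  have an_\<alpha>: "analytic_order_ge 1 (\<lambda>t. \<alpha> t p)" if p: "p < k" for p
  proof (rule analytic_order_ge_vanish)
    show "\<alpha> 0 p = 0" using coef_a_self[OF model p] by (simp add: \<alpha>_def at0 ta_def)
    have i1: "integrable \<nu> (\<lambda>z. bu z * (ta z * e p z))" and i2: "integrable \<nu> (\<lambda>z. bu z * e p z)"
      by (intro bounded_meas_integrable_mult bu sq_int_mult_integrable sq_int_integrable e p sq)+
    show "analytic_order_ge 0 (\<lambda>t. \<alpha> t p)"
    proof (rule analytic_order_ge_cong[OF analytic_order_ge_diff[OF an_g[OF i1] an_h[OF i2 m(2) d(1)]]])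
      from ev show "\<forall>\<^sub>F t in nhds 0. (\<integral>z. bu z * (ta z * e p z) * (f z * (1 + t * df z) / (a z + t * da z)) \<partial>\<nu>)
        - (\<integral>z. (a z + t * da z) * (bu z * e p z) * (f z * (1 + t * df z) / (a z + t * da z)) \<partial>\<nu>) = \<alpha> t p"
      proof eventually_elim
        case (elim t)
        have g: "integrable \<nu> (\<lambda>z. V z * (f' t z / a' t z))" if "integrable \<nu> V" for V
          using bounded_meas_integrable_mult[OF modelD(5)[OF elim] that] by (simp add: mult.commute)
        have "(\<integral>z. bu z * (ta z * e p z) * (f' t z / a' t z) \<partial>\<nu>) - (\<integral>z. a' t z * (bu z * e p z) * (f' t z / a' t z) \<partial>\<nu>) = \<alpha> t p"
          unfolding \<alpha>_def coef_a_def
          by (subst Bochner_Integration.integral_diff[symmetric, OF g[OF i1] g[OF bounded_meas_integrable_mult[OF modelD(2)[OF elim] i2]]])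
             (intro Bochner_Integration.integral_cong refl, simp add: algebra_simps del: times_divide_eq_left times_divide_eq_right)
        then show ?case by (simp only: a'_def f'_def)
      qed
    qed
  qed
  have an_\<beta>: "analytic_order_ge 1 (\<lambda>t. \<beta> t p)" if p: "p < k" for p
  proof (rule analytic_order_ge_vanish)
    show "\<beta> 0 p = 0" using coef_b_self[OF model p] by (simp add: \<beta>_def at0 tb_def)
    have i1: "integrable \<nu> (\<lambda>z. au z * (tb z * e p z))" and i2: "integrable \<nu> (\<lambda>z. au z * e p z)"
      by (intro bounded_meas_integrable_mult au sq_int_mult_integrable sq_int_integrable e p sq)+
    show "analytic_order_ge 0 (\<lambda>t. \<beta> t p)"
    proof (rule analytic_order_ge_cong[OF analytic_order_ge_diff[OF an_h[OF i2 m(3) d(2)] an_g[OF i1]]])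
      from ev show "\<forall>\<^sub>F t in nhds 0. (\<integral>z. (b z + t * db z) * (au z * e p z) * (f z * (1 + t * df z) / (a z + t * da z)) \<partial>\<nu>)
        - (\<integral>z. au z * (tb z * e p z) * (f z * (1 + t * df z) / (a z + t * da z)) \<partial>\<nu>) = \<beta> t p"
      proof eventually_elim
        case (elim t)
        have g: "integrable \<nu> (\<lambda>z. V z * (f' t z / a' t z))" if "integrable \<nu> V" for V
          using bounded_meas_integrable_mult[OF modelD(5)[OF elim] that] by (simp add: mult.commute)
        have "(\<integral>z. b' t z * (au z * e p z) * (f' t z / a' t z) \<partial>\<nu>) - (\<integral>z. au z * (tb z * e p z) * (f' t z / a' t z) \<partial>\<nu>) = \<beta> t p"
          unfolding \<beta>_def coef_b_def
          by (subst Bochner_Integration.integral_diff[symmetric, OF g[OF bounded_meas_integrable_mult[OF modelD(3)[OF elim] i2]] g[OF i1]])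
             (intro Bochner_Integration.integral_cong refl, simp add: algebra_simps del: times_divide_eq_left times_divide_eq_right)
        then show ?case by (simp only: a'_def b'_def f'_def)
      qed
    qed
  qed
  have an_\<sigma>: "analytic_order_ge 0 \<sigma>"
  proof -
    note i = sq_int_integrable[OF sq(1)] sq_int_mult_integrable[OF sq] sq_int_integrable[OF sq(2)]
    show ?thesis
    proof (rule analytic_order_ge_cong[OF analytic_order_ge_add[OF analytic_order_ge_diff[OF an_h[OF i(1) m(3) d(2)] an_g[OF i(2)]] an_h[OF i(3) m(2) d(1)]]])
      from ev show "\<forall>\<^sub>F t in nhds 0. (\<integral>z. (b z + t * db z) * ta z * (f z * (1 + t * df z) / (a z + t * da z)) \<partial>\<nu>)
        - (\<integral>z. ta z * tb z * (f z * (1 + t * df z) / (a z + t * da z)) \<partial>\<nu>)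
        + (\<integral>z. (a z + t * da z) * tb z * (f z * (1 + t * df z) / (a z + t * da z)) \<partial>\<nu>) = \<sigma> t"
      proof eventually_elim
        case (elim t)
        have g: "integrable \<nu> (\<lambda>z. V z * (f' t z / a' t z))" if "integrable \<nu> V" for V
          using bounded_meas_integrable_mult[OF modelD(5)[OF elim] that] by (simp add: mult.commute)
        note g' = g[OF bounded_meas_integrable_mult[OF modelD(3)[OF elim] i(1)]] g[OF i(2)]
          g[OF bounded_meas_integrable_mult[OF modelD(2)[OF elim] i(3)]]
        have "(\<integral>z. b' t z * ta z * (f' t z / a' t z) \<partial>\<nu>) - (\<integral>z. ta z * tb z * (f' t z / a' t z) \<partial>\<nu>)
            + (\<integral>z. a' t z * tb z * (f' t z / a' t z) \<partial>\<nu>) = \<sigma> t"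
          unfolding \<sigma>_def distrib_right left_diff_distrib
          using g' by (simp only: Bochner_Integration.integral_add Bochner_Integration.integral_diff Bochner_Integration.integrable_diff)
        then show ?case by (simp only: a'_def b'_def f'_def)
      qed
    qed
  qed
  have an_M: "analytic_order_ge 1 (\<lambda>t. M t r p)" if "r < k" "p < k" for r p
  proof (rule analytic_order_ge_vanish)
    show "M 0 r p = 0" by (simp add: M_def G_def C_def at0)
    show "analytic_order_ge 0 (\<lambda>t. M t r p)"
      unfolding M_def by (intro analytic_order_ge_diff an_G that analytic_order_ge_const)
  qed
  have an_row: "analytic_order_ge (Suc n) (\<lambda>t. ?row t n q)" if "q < k" for n q
    by (rule row_chain_analytic[OF an_\<alpha> an_M that])
  have an_\<gamma>: "analytic_order_ge 1 (\<lambda>t. \<gamma> t p)" if p: "p < k" for p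
  proof -
    have det: "analytic_order_ge 0 (\<lambda>t. Determinant.det (G t))"
      by (rule analytic_order_ge_det[OF G_carrier an_G])
    have "Determinant.det (G 0) \<noteq> 0"
      using gram_at_det[OF model] by (simp add: G_def at0)
    from analytic_order_ge_inverse[OF det this]
    have inv: "analytic_order_ge 0 (\<lambda>t. inverse (Determinant.det (G t)))" .
    have "analytic_order_ge 1 (\<lambda>t. \<Sum>q<k. adj_mat (G t) $$ (p, q) * \<beta> t q)"
      by (intro analytic_order_ge_sum analytic_order_ge_mult0 analytic_order_ge_adj_mat[OF G_carrier an_G] an_\<beta>)
         (use p in auto)
    from analytic_order_ge_mult[OF this inv] show ?thesis by (simp add: \<gamma>_def)
  qed
  \<comment> \<open>The definition also requires the sum of influence means itself to be
    differentiable; its closed form near 0 provides this.\<close>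
  have an_\<psi>: "analytic_order_ge 0 \<psi>"
  proof (rule analytic_order_ge_cong)
    have "analytic_order_ge 0 (\<lambda>t. ?row t n q * \<beta> t q)" if "q < k" for n q
      by (rule analytic_order_ge_mono[OF analytic_order_ge_mult[OF an_row[OF that] an_\<beta>[OF that]]]) simp
    then have "analytic_order_ge 0 (\<lambda>t. (-1) ^ n * (\<Sum>q<k. ?row t n q * \<beta> t q))" for n
      by (intro analytic_order_ge_mult0[OF analytic_order_ge_const] analytic_order_ge_sum) simp
    then show "analytic_order_ge 0 (\<lambda>t. \<sigma> t - \<chi>0 - (\<Sum>n<m - 1. (-1) ^ n * (\<Sum>q<k. ?row t n q * \<beta> t q)))"
      by (intro analytic_order_ge_diff an_\<sigma> analytic_order_ge_const analytic_order_ge_sum)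
    from ev show "\<forall>\<^sub>F t in nhds 0. \<sigma> t - \<chi>0 - (\<Sum>n<m - 1. (-1) ^ n * (\<Sum>q<k. ?row t n q * \<beta> t q)) = \<psi> t"
      by eventually_elim (simp add: \<psi>_eq)
  qed
  have an_\<rho>: "analytic_order_ge (m + 1) (\<lambda>t. - \<rho> t)"
  proof -
    have Cg: "analytic_order_ge 1 (\<lambda>t. \<Sum>r<k. C q r * \<gamma> t r)" for q
      by (intro analytic_order_ge_sum analytic_order_ge_mult0 analytic_order_ge_const an_\<gamma>) simp
    have "analytic_order_ge (m + 1) (\<lambda>t. ?row t (m - 1) q * (\<Sum>r<k. C q r * \<gamma> t r))" if "q < k" for q
      \<comment> \<open>The chain with \<open>m - 1\<close> middle factors has order
        \<open>Suc (m - 1)\<close>, which is \<open>m\<close> because \<open>1 \<le> m\<close>;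
        \<open>\<gamma>\<close> adds one more since it is linear in \<open>\<beta>\<close>, which
        vanishes at 0.\<close>
      using analytic_order_ge_mult[OF an_row[OF that] Cg, of "m - 1" q] j by simp
    then show ?thesis
      unfolding \<rho>_def
      by (intro analytic_order_ge_minus analytic_order_ge_mult0[OF analytic_order_ge_const] analytic_order_ge_sum) simp
  qed
  have "same_nth_deriv j 0 (\<lambda>t. chi_tilde \<nu> ahat au bhat bu L (a' t) (b' t) (f' t)) \<psi>"
  proof (rule same_nth_deriv_analytic[OF an_\<psi> an_\<rho>])
    show "0 < j" "j < m + 1" using j by auto
    from ev show "\<forall>\<^sub>F t in nhds 0. chi_tilde \<nu> ahat au bhat bu L (a' t) (b' t) (f' t) = \<chi>0 + \<psi> t + - \<rho> t"
      by eventually_elim (rule chi_eq)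
  qed
  then show "same_nth_deriv j 0
     (\<lambda>t. chi_tilde \<nu> ahat au bhat bu L (\<lambda>z. a z + t * da z) (\<lambda>z. b z + t * db z) (\<lambda>z. f z * (1 + t * df z)))
     (\<lambda>t. \<Sum>i=1..m. 1 / fact i * (\<integral>x. ?infl i x \<partial>iid i (law \<nu> (\<lambda>z. a z + t * da z) (\<lambda>z. b z + t * db z) (\<lambda>z. f z * (1 + t * df z)))))"
    by (simp only: \<psi>_def[abs_def] a'_def[abs_def] b'_def[abs_def] f'_def[abs_def])
qed

end

theorem theorem7p2:
  fixes \<nu> :: "'z measure"
    and a b f ahat au bhat bu :: "'z \<Rightarrow> real"
    and L :: "('z \<Rightarrow> real) set"
    and k :: nat and e :: "nat \<Rightarrow> 'z \<Rightarrow> real"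
  assumes "model \<nu> a b f"
    and "bounded_meas \<nu> ahat" "bounded_meas \<nu> au" "bounded_meas \<nu> bhat" "bounded_meas \<nu> bu"
    and "bounded_away \<nu> {0<..} au" "bounded_away \<nu> {0<..} bu"
    and "L2_subspace \<nu> L" "L2_basis \<nu> L k e"
  defines "P \<equiv> law \<nu> a b f"
    and "Ker \<equiv> proj_kernel \<nu> (weight au bu a f) k e"
    and "At \<equiv> A_tilde \<nu> ahat au bu L a f"
    and "Yt \<equiv> Y_tilde \<nu> bhat au bu L a b f"
  shows "influence_functions \<nu> (chi_tilde \<nu> ahat au bhat bu L) a b f
    (\<lambda>m. if m = 1 then (\<lambda>x. chi_tilde_1 \<nu> ahat au bhat bu L a b f (x 1))
         else degenerate_part P m (\<lambda>x. (-1) ^ (m - 1) * fact m *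
                (At (x 1) * (\<Prod>i=1..<m. Ker (obs_Z (x i)) (obs_Z (x (i + 1))))
                 * (\<Prod>i=2..<m. A_und au bu (x i)) * Yt (x m))))"
proof -
  interpret finite_measure \<nu> by (rule modelD(1)) fact
  interpret approx_functional \<nu> L k e ahat au bhat bu
    by standard fact+
  show ?thesis
    unfolding P_def Ker_def At_def Yt_def by (rule influence_functions_chi_tilde) fact
qed

end
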